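(* Let $\Lambda$ be a uniformly discrete approximate subgroup in a unimodular second countable locally compact group $G$, and let $\mu_G$ be a left-Haar measure on $G$. There is some Borel subset $\mathcal{F}\subset G$ with finite Haar measure such that $\mathcal{F}\Lambda=G$ if and only if there exist a Borel probability measure $\nu$ on $\Omega_\Lambda$ and a constant $C\geq 1$ such that $$\frac{1}{C}\mu_G\leq \mathcal{P}_\Lambda^*\nu\leq C\mu_G .$$
   Context: A subset $\Lambda$ of a group $G$ is an approximate subgroup if $\Lambda=\Lambda^{-1}$, $e\in\Lambda$ and $\Lambda^2\subset F\Lambda$ for some finite $F\subset G$. A subset $X$ of a locally compact group $G$ is uniformly discrete if there is an open set $U\subset G$ with $X^{-1}X\cap U=\{e\}$. $\mathcal{C}(G)$ is the set of closed subsets of $G$ with the Chabauty--Fell topology, generated by the sets $\{F:F\cap V\neq\emptyset\}$ ($V$ open) and $\{F:F\cap K=\emptyset\}$ ($K$ compact); $G$ acts continuously by $(g,F)\mapsto gF$. The invariant hull of $\Lambda$ is $\Omega_\Lambda=\overline{\{g\Lambda:g\in G\}}$ and the extended invariant hull is $\Omega_\Lambda^{ext}=\{X\in\mathcal{C}(G):X^{-1}X\subset\overline{\Lambda^{-1}\Lambda}\}$; one has $\Omega_\Lambda\subset\Omega_\Lambda^{ext}$. The periodization map $\mathcal{P}_\Lambda:C^0_c(G)\to C^0(\Omega_\Lambda^{ext})$ is defined by $\mathcal{P}_\Lambda(f)(X)=\sum_{x\in X}f(x)$, where $C_c^0(G)$ is the space of compactly supported continuous functions on $G$. For a Borel probability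 measure $\nu$ on $\Omega_\Lambda$ (or $\Omega_\Lambda^{ext}$), $\mathcal{P}_\Lambda^*\nu$ is the Radon measure on $G$ determined by $\int_G f\,d(\mathcal{P}_\Lambda^*\nu)=\int\mathcal{P}_\Lambda(f)\,d\nu$ for $f\in C^0_c(G)$. *)

theory Defs
  imports "HOL-Probability.Probability" "HOL-Library.Set_Algebras"
begin

text \<open>
  Groups are written additively: class \<open>topological_group_add\<close> extends \<open>group_add\<close>, which is
  not assumed to be commutative. Thus \<open>g +o X\<close> is the left translate $gX$, \<open>A + B\<close> on sets is
  the product set $AB$, and \<open>uminus ` X + X\<close> is $X^{-1}X$. Order of summands matters throughout.
\<close>

definition approximate_subgroup :: "'a::group_add set \<Rightarrow> bool" where
  "approximate_subgroup \<Lambda> \<longleftrightarrow>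
     \<Lambda> = uminus ` \<Lambda> \<and> 0 \<in> \<Lambda> \<and> (\<exists>F. finite F \<and> \<Lambda> + \<Lambda> \<subseteq> F + \<Lambda>)"

definition uniformly_discrete :: "'a::topological_group_add set \<Rightarrow> bool" where
  "uniformly_discrete X \<longleftrightarrow> (\<exists>U. open U \<and> (uminus ` X + X) \<inter> U = {0})"

definition chabauty_fell :: "'a::topological_space set topology" where
  "chabauty_fell = topology_generated_by
     ({{F. closed F \<and> F \<inter> V \<noteq> {}} | V. open V} \<union> {{F. closed F \<and> F \<inter> K = {}} | K. compact K})"

definition invariant_hull :: "'a::topological_group_add set \<Rightarrow> 'a set set" where
  "invariant_hull \<Lambda> = chabauty_fell closure_of (range (\<lambda>g. g +o \<Lambda>))"

definition ext_invariant_hull :: "'a::topological_group_add set \<Rightarrow> 'a set set" where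
  "ext_invariant_hull \<Lambda> = {X. closed X \<and> uminus ` X + X \<subseteq> closure (uminus ` \<Lambda> + \<Lambda>)}"

definition borel_of_topology :: "'b topology \<Rightarrow> 'b measure" where
  "borel_of_topology T = sigma (topspace T) {U. openin T U}"

definition borel_prob_on_hull :: "'a::topological_group_add set \<Rightarrow> 'a set measure \<Rightarrow> bool" where
  "borel_prob_on_hull \<Lambda> \<nu> \<longleftrightarrow>
     sets \<nu> = sets (borel_of_topology (subtopology chabauty_fell (invariant_hull \<Lambda>))) \<and>
     prob_space \<nu>"

definition Cc :: "('a::topological_space \<Rightarrow> real) set" where
  "Cc = {f. continuous_on UNIV f \<and> compact (closure {x. f x \<noteq> 0})}"

text \<open>
  \<open>X\<close> is usually infinite, where \<open>\<Sum>\<close> would be 0 by convention. For \<open>f \<in> Cc\<close> and locally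
  finite \<open>X\<close> only finitely many terms are nonzero and \<open>\<Sum>\<^sub>\<infinity>\<close> is their sum.
\<close>

definition periodization ::
    "'a::topological_group_add set \<Rightarrow> ('a \<Rightarrow> real) \<Rightarrow> 'a set \<Rightarrow> real" where
  "periodization \<Lambda> f = (\<lambda>X\<in>ext_invariant_hull \<Lambda>. \<Sum>\<^sub>\<infinity>x\<in>X. f x)"

definition radon_measure :: "'a::topological_space measure \<Rightarrow> bool" where
  "radon_measure M \<longleftrightarrow> sets M = sets borel \<and>
     (\<forall>K. compact K \<longrightarrow> emeasure M K < \<infinity>) \<and>
     (\<forall>A\<in>sets borel. emeasure M A = (INF U\<in>{U. open U \<and> A \<subseteq> U}. emeasure M U)) \<and>
     (\<forall>U. open U \<longrightarrow> emeasure M U = (SUP K\<in>{K. compact K \<and> K \<subseteq> U}. emeasure M K))"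

definition periodization_dual ::
    "'a::topological_group_add set \<Rightarrow> 'a set measure \<Rightarrow> 'a measure" where
  "periodization_dual \<Lambda> \<nu> = (THE \<eta>. radon_measure \<eta> \<and>
     (\<forall>f\<in>Cc. (\<integral>x. f x \<partial>\<eta>) = (\<integral>X. periodization \<Lambda> f X \<partial>\<nu>)))"

definition left_haar_measure :: "'a::topological_group_add measure \<Rightarrow> bool" where
  "left_haar_measure \<mu> \<longleftrightarrow> radon_measure \<mu> \<and> emeasure \<mu> UNIV \<noteq> 0 \<and>
     (\<forall>g. \<forall>A\<in>sets borel. emeasure \<mu> ((\<lambda>x. g + x) ` A) = emeasure \<mu> A)"

definition unimodular :: "'a::topological_group_add itself \<Rightarrow> bool" where
  "unimodular _ \<longleftrightarrow> (\<forall>\<mu> :: 'a measure. left_haar_measure \<mu> \<longrightarrow>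
     (\<forall>g. \<forall>A\<in>sets borel. emeasure \<mu> ((\<lambda>x. x + g) ` A) = emeasure \<mu> A))"

end

theory Submission
  imports Defs
begin

text \<open>
  Put \<open>D = - \<Lambda> + \<Lambda>\<close>, a closed countable set, and choose a Borel set \<open>E\<close> that is a maximal
  \<open>D\<close>-packing: \<open>(- E + E) \<inter> D \<subseteq> {0}\<close> and \<open>E + D = UNIV\<close>. Since \<open>D\<close> is covered by finitely many
  translates of \<open>\<Lambda>\<close>, some \<open>E + T\<close> with \<open>T\<close> finite satisfies \<open>E + T + \<Lambda> = UNIV\<close>, so both
  conditions amount to \<open>\<mu> E < \<infinity>\<close>.

  The measure \<open>A \<mapsto> \<integral> |X \<inter> A| d\<nu>(X)\<close> is the dual of the periodization map. Every \<open>X\<close> in the hull has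
  \<open>- X + X \<subseteq> D\<close> and so meets \<open>E\<close> at most once; hence this measure gives \<open>E\<close> mass at most 1, and
  \<open>\<mu> E \<le> C\<close>.

  Conversely, with \<open>n\<^sub>A(x) = |(x + \<Lambda>) \<inter> A|\<close>, unimodularity gives \<open>\<integral>\<^sub>A n\<^sub>B d\<mu> = \<integral>\<^sub>B n\<^sub>A d\<mu>\<close>. If
  \<open>F + \<Lambda> = UNIV\<close>, then \<open>n\<^sub>F \<ge> 1\<close> and \<open>n\<^sub>E \<le> 1\<close>, so \<open>\<mu> E \<le> \<mu> F\<close>. Let \<open>\<nu>\<close> be the law of \<open>x + \<Lambda>\<close> for
  \<open>x\<close> uniform in \<open>G = E + T\<close>; the same identity shows that its dual has density \<open>n\<^sub>G / \<mu> G\<close>, and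
  \<open>n\<^sub>G\<close> lies between 1 and a constant.
\<close>

subsection \<open>Radon measures on second countable locally compact spaces\<close>

lemma Hausdorff_space_euclidean: "Hausdorff_space (euclidean :: 'a::t2_space topology)"
  by (simp add: Hausdorff_space_def disjnt_def) (meson hausdorff)

lemma locally_compact_nhd:
  fixes x :: "'a::{t2_space}"
  assumes "locally_compact_space (euclidean :: 'a topology)" "open U" "x \<in> U"
  shows "\<exists>V K. open V \<and> compact K \<and> x \<in> V \<and> V \<subseteq> K \<and> K \<subseteq> U"
proof -
  have "neighbourhood_base_of (compactin euclidean) (euclidean :: 'a topology)"
    using assms(1) locally_compact_space_neighbourhood_base[OF disjI1[OF Hausdorff_space_euclidean[where ?'a = 'a]]] by simp
  then show ?thesis
    using assms(2,3) by (simp add: neighbourhood_base_of)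
qed

text \<open>The Lindelof property, with the chosen points indexed by \<open>nat\<close>;
  nonemptiness of \<open>S\<close> provides a value at every index.\<close>

lemma countable_open_subcover:
  fixes S :: "'a::second_countable_topology set"
  assumes "\<And>x. x \<in> S \<Longrightarrow> open (N x)" "\<And>x. x \<in> S \<Longrightarrow> x \<in> N x" "S \<noteq> {}"
  obtains s :: "nat \<Rightarrow> 'a" where "range s \<subseteq> S" "S \<subseteq> (\<Union>n. N (s n))"
proof -
  obtain F' where F': "F' \<subseteq> N ` S" "countable F'" "\<Union>F' = \<Union>(N ` S)"
    by (rule Lindelof[of "N ` S"]) (use assms(1) in auto)
  obtain T where T: "T \<subseteq> S" "countable T" "F' = N ` T"
    using F'(1,2) by (meson countable_subset_image)
  have ne: "T \<noteq> {}"
    using F'(3) T(3) assms(2,3) by auto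
  show thesis
  proof
    show "range (from_nat_into T) \<subseteq> S"
      using range_from_nat_into[OF ne T(2)] T(1) by simp
    have "S \<subseteq> \<Union>(N ` T)"
      using F'(3) T(3) assms(2) by auto
    then show "S \<subseteq> (\<Union>n. N (from_nat_into T n))"
      using range_from_nat_into[OF ne T(2)] by (metis (no_types) image_image)
  qed
qed

text \<open>Every point of \<open>U\<close> has a compact neighbourhood inside \<open>U\<close>;
  countably many of these cover \<open>U\<close>, and taking finite unions makes the sequence
  increasing.\<close>

lemma open_sigma_compact:
  fixes U :: "'a::{t2_space, second_countable_topology} set"
  assumes lc: "locally_compact_space (euclidean :: 'a topology)" and "open U"
  shows "\<exists>K :: nat \<Rightarrow> 'a set. (\<forall>n. compact (K n)) \<and> incseq K \<and> (\<Union>n. K n) = U"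
proof (cases "U = {}")
  case True
  then show ?thesis
    by (intro exI[of _ "\<lambda>_. {}"]) (auto simp: incseq_def)
next
  case False
  have "\<forall>x\<in>U. \<exists>V K. open V \<and> compact K \<and> x \<in> V \<and> V \<subseteq> K \<and> K \<subseteq> U"
    using locally_compact_nhd[OF lc \<open>open U\<close>] by simp
  then obtain V K where VK: "\<And>x. x \<in> U \<Longrightarrow> open (V x) \<and> compact (K x) \<and> x \<in> V x \<and> V x \<subseteq> K x \<and> K x \<subseteq> U"
    by metis
  obtain s :: "nat \<Rightarrow> 'a" where s: "range s \<subseteq> U" "U \<subseteq> (\<Union>n. V (s n))"
    by (rule countable_open_subcover[of U V]) (use VK False in auto)
  show ?thesis
  proof (intro exI[of _ "\<lambda>n. \<Union>i\<le>n. K (s i)"] conjI allI)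
    show "compact (\<Union>i\<le>n. K (s i))" for n
      using s(1) VK by (intro compact_UN) auto
    show "incseq (\<lambda>n. \<Union>i\<le>n. K (s i))"
      unfolding incseq_def by fastforce
    have "(\<Union>n. \<Union>i\<le>n. K (s i)) \<subseteq> U"
      using s(1) VK by blast
    moreover have "U \<subseteq> (\<Union>n. \<Union>i\<le>n. K (s i))"
    proof
      fix x assume "x \<in> U"
      then obtain n where "x \<in> V (s n)" using s(2) by blast
      then have "x \<in> K (s n)" using VK s(1) by blast
      then show "x \<in> (\<Union>n. \<Union>i\<le>n. K (s i))" by blast
    qed
    ultimately show "(\<Union>n. \<Union>i\<le>n. K (s i)) = U" by blast
  qed
qed

text \<open>The sets with such approximations form a Dynkin system containing the open sets. Open
  sets are exhausted from inside by compact ones, and complements exchange the roles of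
  \<open>C\<close> and \<open>U\<close>.\<close>

lemma finite_measure_closed_open_approx:
  fixes N :: "'a::{t2_space, second_countable_topology} measure"
  assumes lc: "locally_compact_space (euclidean :: 'a topology)"
    and "finite_measure N" and sN: "sets N = sets borel"
    and "A \<in> sets borel" and "(0::real) < e"
  shows "\<exists>C U. closed C \<and> open U \<and> C \<subseteq> A \<and> A \<subseteq> U \<and> measure N (U - C) < e"
proof -
  interpret finite_measure N by fact
  have "Int_stable {S::'a set. open S}"
    by (auto simp: Int_stable_def)
  moreover have "{S::'a set. open S} \<subseteq> Pow UNIV" by simp
  moreover have "A \<in> sigma_sets UNIV {S. open S}"
    using \<open>A \<in> sets borel\<close> by (simp add: sets_borel)
  ultimately show ?thesis
    using \<open>0 < e\<close>
  proof (induction A arbitrary: e rule: sigma_sets_induct_disjoint)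
    case (basic A)
    then have "open A" by simp
    obtain K :: "nat \<Rightarrow> 'a set" where K: "\<And>n. compact (K n)" "incseq K" "(\<Union>n. K n) = A"
      using open_sigma_compact[OF lc \<open>open A\<close>] by blast
    have cK: "closed (K n)" for n
      using K(1) compact_imp_closed by blast
    have "(\<lambda>n. measure N (A - K n)) \<longlonglongrightarrow> measure N (\<Inter>n. A - K n)"
      using \<open>open A\<close> cK K(2)
      by (intro finite_Lim_measure_decseq) (auto simp: decseq_def incseq_def sN)
    moreover have "(\<Inter>n. A - K n) = {}"
      using K(3) by auto
    ultimately have "(\<lambda>n. measure N (A - K n)) \<longlonglongrightarrow> 0"
      by (metis measure_empty)
    then have "eventually (\<lambda>n. measure N (A - K n) < e) sequentially"
      using \<open>0 < e\<close> by (simp add: order_tendsto_iff)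
    then obtain n where "measure N (A - K n) < e"
      using eventually_happens sequentially_bot by blast
    then show ?case
      using cK K(3) \<open>open A\<close> by blast
  next
    case empty
    then show ?case by (intro exI[of _ "{}"]) auto
  next
    case (compl A)
    obtain C U where CU: "closed C" "open U" "C \<subseteq> A" "A \<subseteq> U" "measure N (U - C) < e"
      using compl.IH[OF compl.prems] by blast
    have "(UNIV - C) - (UNIV - U) = U - C" by auto
    then show ?case
      using CU by (intro exI[of _ "UNIV - U"] exI[of _ "UNIV - C"]) (auto simp: Compl_eq_Diff_UNIV[symmetric])
  next
    case (union A)
    \<comment> \<open>The errors sum to \<open>e / 2\<close>; the other half leaves room for
      replacing the infinite union of the \<open>C i\<close> by a finite one.\<close>
    have "\<forall>i. \<exists>C U. closed C \<and> open U \<and> C \<subseteq> A i \<and> A i \<subseteq> U \<and> measure N (U - C) < e / 2 * (1/2)^Suc i"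
    proof
      fix i
      have "0 < e / 2 * (1/2)^Suc i" using union.prems by simp
      then show "\<exists>C U. closed C \<and> open U \<and> C \<subseteq> A i \<and> A i \<subseteq> U \<and> measure N (U - C) < e / 2 * (1/2)^Suc i"
        by (rule union.IH)
    qed
    then obtain C U where CU: "\<And>i. closed (C i)" "\<And>i. open (U i)" "\<And>i. C i \<subseteq> A i" "\<And>i. A i \<subseteq> U i"
      "\<And>i. measure N (U i - C i) < e / 2 * (1/2)^Suc i"
      by metis
    let ?D = "\<lambda>n. \<Union>i\<le>n. C i" let ?V = "\<Union>i. U i"
    have oV: "open ?V" and cD: "closed (?D n)" for n
      using CU(1,2) by auto
    have [measurable]: "U i \<in> sets borel" "C i \<in> sets borel" for i
      using CU(1,2) by auto
    \<comment> \<open>An infinite union of closed sets need not be closed, so it is truncated;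
      continuity from above controls the loss.\<close>
    have "(\<lambda>n. measure N (?V - ?D n)) \<longlonglongrightarrow> measure N (\<Inter>n. ?V - ?D n)"
      using oV cD
      by (intro finite_Lim_measure_decseq) (auto simp: decseq_def sN intro: order_trans)
    moreover have "measure N (\<Inter>n. ?V - ?D n) < e"
    proof -
      have sm: "(\<lambda>i. e / 2 * (1/2)^Suc i) sums (e / 2)"
        using sums_mult[OF power_half_series, of "e/2"] by simp
      have s2: "summable (\<lambda>i. measure N (U i - C i))"
      proof (rule summable_comparison_test[OF _ sums_summable[OF sm]], intro exI allI impI)
        fix n show "norm (measure N (U n - C n)) \<le> e / 2 * (1 / 2) ^ Suc n"
          using less_imp_le[OF CU(5)[of n]] by simp
      qed
      have "measure N (\<Inter>n. ?V - ?D n) \<le> measure N (\<Union>i. U i - C i)"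
        by (intro finite_measure_mono) (auto simp: sN)
      also have "\<dots> \<le> (\<Sum>i. measure N (U i - C i))"
        using s2 by (intro finite_measure_subadditive_countably) (auto simp: sN)
      also have "\<dots> \<le> (\<Sum>i. e / 2 * (1/2)^Suc i)"
        by (intro suminf_le s2 sums_summable[OF sm] less_imp_le CU(5))
      also have "\<dots> = e / 2" using sm by (simp add: sums_unique[symmetric])
      also have "\<dots> < e" using union.prems by simp
      finally show ?thesis .
    qed
    ultimately have "eventually (\<lambda>n. measure N (?V - ?D n) < e) sequentially"
      by (simp add: order_tendsto_iff)
    then obtain n where "measure N (?V - ?D n) < e"
      using eventually_happens sequentially_bot by blast
    moreover have "?D n \<subseteq> (\<Union>i. A i)" "(\<Union>i. A i) \<subseteq> ?V"
      using CU(3,4) by blast+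
    ultimately show ?case
      using oV cD by (intro exI[of _ "?D n"] exI[of _ ?V] conjI)
  qed
qed

text \<open>Countably many open sets of finite measure cover the space, and the approximation for
  finite measures is applied in each of them with errors summing to \<open>e\<close>. Inner
  regularity is sigma-compactness of open sets.\<close>

lemma radon_measureI:
  fixes M :: "'a::{t2_space, second_countable_topology} measure"
  assumes lc: "locally_compact_space (euclidean :: 'a topology)"
    and sM: "sets M = sets borel"
    and fin: "\<And>K. compact K \<Longrightarrow> emeasure M K < \<infinity>"
  shows "radon_measure M"
proof -
  have "\<exists>V K. open V \<and> compact K \<and> x \<in> V \<and> V \<subseteq> K" for x :: 'a
    using locally_compact_nhd[OF lc open_UNIV, of x] by auto
  then obtain V K where VK: "\<And>x::'a. open (V x) \<and> compact (K x) \<and> x \<in> V x \<and> V x \<subseteq> K x"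
    by metis
  obtain s :: "nat \<Rightarrow> 'a" where s: "UNIV \<subseteq> (\<Union>n. V (s n))"
    by (rule countable_open_subcover[of UNIV V]) (use VK in auto)
  define W where "W = (\<lambda>n. V (s n))"
  have oW: "open (W n)" and fW: "emeasure M (W n) < \<infinity>" for n
  proof -
    show "open (W n)" using VK by (simp add: W_def)
    have "emeasure M (W n) \<le> emeasure M (K (s n))"
      using VK by (intro emeasure_mono) (auto simp: W_def sM compact_imp_closed)
    also have "\<dots> < \<infinity>" using VK fin by blast
    finally show "emeasure M (W n) < \<infinity>" .
  qed
  have outer: "emeasure M A = (INF U\<in>{U. open U \<and> A \<subseteq> U}. emeasure M U)" if A: "A \<in> sets borel" for A
  proof (rule antisym)
    show "emeasure M A \<le> (INF U\<in>{U. open U \<and> A \<subseteq> U}. emeasure M U)"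
      by (intro INF_greatest emeasure_mono) (auto simp: sM)
    show "(INF U\<in>{U. open U \<and> A \<subseteq> U}. emeasure M U) \<le> emeasure M A"
    proof (rule ennreal_le_epsilon)
      fix e :: real assume "0 < e"
      have "\<exists>U. open U \<and> A \<subseteq> U \<and> emeasure M ((U - A) \<inter> W n) \<le> ennreal (e * (1/2)^Suc n)" for n
      proof -
        \<comment> \<open>This is \<open>M\<close> cut down to \<open>W n\<close> but still defined
          on the whole space, so the finite case applies to \<open>A\<close> itself.\<close>
        let ?N = "density M (indicator (W n))"
        have Wn[measurable]: "W n \<in> sets borel" using oW by auto
        have em: "emeasure ?N B = emeasure M (B \<inter> W n)" if "B \<in> sets borel" for B
          using that Wn by (simp add: emeasure_restricted sM Int_commute)
        have fN: "finite_measure ?N"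
          using em[of UNIV] fW[of n] by (intro finite_measureI) (auto simp: sets_eq_imp_space_eq[OF sM])
        interpret finite_measure ?N by fact
        have sN: "sets ?N = sets borel" and e: "0 < e * (1/2)^Suc n"
          using \<open>0 < e\<close> by (simp_all add: sM)
        obtain C U where CU: "closed C" "open U" "C \<subseteq> A" "A \<subseteq> U" "measure ?N (U - C) < e * (1/2)^Suc n"
          using finite_measure_closed_open_approx[OF lc fN sN A e] by (elim exE conjE)
        have "emeasure M ((U - A) \<inter> W n) \<le> emeasure M ((U - C) \<inter> W n)"
          using CU(1,2,3) oW by (intro emeasure_mono) (auto simp: sM)
        also have "\<dots> = ennreal (measure ?N (U - C))"
          using em[of "U - C"] CU(1,2) by (simp add: emeasure_eq_measure)
        also have "\<dots> \<le> ennreal (e * (1/2)^Suc n)"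
          using CU(5) by (intro ennreal_leI) simp
        finally show ?thesis using CU by blast
      qed
      then obtain U where U: "\<And>n. open (U n)" "\<And>n. A \<subseteq> U n"
        "\<And>n. emeasure M ((U n - A) \<inter> W n) \<le> ennreal (e * (1/2)^Suc n)"
        by metis
      let ?U = "\<Union>n. U n \<inter> W n"
      have oU: "open ?U" using U(1) oW by auto
      have AU: "A \<subseteq> ?U"
      proof
        fix x assume "x \<in> A"
        moreover obtain n where "x \<in> W n" using s by (auto simp: W_def)
        ultimately show "x \<in> ?U" using U(2) by blast
      qed
      have "emeasure M (?U - A) \<le> emeasure M (\<Union>n. (U n - A) \<inter> W n)"
        using U(1) oW A by (intro emeasure_mono) (auto simp: sM intro!: sets.countable_UN)
      also have "\<dots> \<le> (\<Sum>n. emeasure M ((U n - A) \<inter> W n))"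
        using U(1) oW A by (intro emeasure_subadditive_countably) (auto simp: sM)
      also have "\<dots> \<le> (\<Sum>n. ennreal (e * (1/2)^Suc n))"
        by (intro suminf_le U(3)) auto
      also have "\<dots> = ennreal e"
        using sums_mult[OF power_half_series, of e] \<open>0 < e\<close>
        by (intro suminf_ennreal_eq) auto
      finally have le: "emeasure M (?U - A) \<le> ennreal e" .
      have "(INF U\<in>{U. open U \<and> A \<subseteq> U}. emeasure M U) \<le> emeasure M ?U"
        using oU AU by (intro INF_lower) auto
      also have "\<dots> \<le> emeasure M A + emeasure M (?U - A)"
        using emeasure_subadditive[of A M "?U - A"] A oU AU
        by (simp add: sM Un_absorb1)
      also have "\<dots> \<le> emeasure M A + ennreal e"
        using le by (rule add_left_mono)
      finally show "(INF U\<in>{U. open U \<and> A \<subseteq> U}. emeasure M U) \<le> emeasure M A + ennreal e" .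
    qed
  qed
  have inner: "emeasure M U = (SUP K\<in>{K. compact K \<and> K \<subseteq> U}. emeasure M K)" if U: "open U" for U
  proof (rule antisym)
    obtain L :: "nat \<Rightarrow> 'a set" where L: "\<And>n. compact (L n)" "incseq L" "(\<Union>n. L n) = U"
      using open_sigma_compact[OF lc U] by blast
    have "emeasure M U = (SUP n. emeasure M (L n))"
      using L by (subst SUP_emeasure_incseq) (auto simp: sM compact_imp_closed)
    also have "\<dots> \<le> (SUP K\<in>{K. compact K \<and> K \<subseteq> U}. emeasure M K)"
      using L by (intro SUP_least SUP_upper) auto
    finally show "emeasure M U \<le> (SUP K\<in>{K. compact K \<and> K \<subseteq> U}. emeasure M K)" .
    show "(SUP K\<in>{K. compact K \<and> K \<subseteq> U}. emeasure M K) \<le> emeasure M U"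
      using U by (intro SUP_least emeasure_mono) (auto simp: sM)
  qed
  show ?thesis
    unfolding radon_measure_def using sM fin outer inner by blast
qed

section \<open>Test functions and uniqueness of Radon measures\<close>

lemma Cc_Urysohn:
  fixes U :: "'a::t2_space set"
  assumes lc: "locally_compact_space (euclidean :: 'a topology)" and K: "compact K" "K \<subseteq> U" and U: "open U"
  obtains f where "f \<in> Cc" "\<And>x. 0 \<le> f x" "\<And>x. f x \<le> 1" "\<And>x. x \<in> K \<Longrightarrow> f x = 1" "\<And>x. x \<notin> U \<Longrightarrow> f x = 0"
proof -
  note H = Hausdorff_space_euclidean[where ?'a = 'a]
  obtain V L where VL: "open V" "compact L" "K \<subseteq> V" "V \<subseteq> L"
    using lc K(1) H locally_compact_space_compact_closed_compact[of "euclidean :: 'a topology"]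
    by auto
  have cr: "completely_regular_space (euclidean :: 'a topology)"
    using locally_compact_regular_imp_completely_regular_space lc H by blast
  \<comment> \<open>Intersecting \<open>U\<close> with \<open>V\<close>, which lies in the compact
    set \<open>L\<close>, forces the support of \<open>f\<close> into \<open>L\<close>.\<close>
  have "closedin euclidean (- (U \<inter> V))" "compactin euclidean K" "disjnt (- (U \<inter> V)) K"
    using U VL K by (auto simp: disjnt_def)
  then obtain f where f: "continuous_map euclidean (subtopology euclidean {0..1::real}) f"
      "f ` (- (U \<inter> V)) \<subseteq> {0}" "f ` K \<subseteq> {1}"
    using Urysohn_completely_regular_compact_closed[OF zero_le_one cr, of K "- (U \<inter> V)"]
    by (metis disjnt_sym)
  have "continuous_on UNIV f"
    using f(1) by (simp add: continuous_map_in_subtopology)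
  moreover have "closure {x. f x \<noteq> 0} \<subseteq> L"
    using f(2) VL(4) compact_imp_closed[OF VL(2)] by (intro closure_minimal) blast+
  then have "compact (closure {x. f x \<noteq> 0})"
    using VL(2) by (metis closed_closure compact_Int_closed inf.absorb_iff2)
  ultimately have "f \<in> Cc"
    by (simp add: Cc_def)
  moreover have "f x \<in> {0..1}" for x
    using f(1) by (auto simp: continuous_map_in_subtopology)
  ultimately show thesis
    using f(2,3) that[of f] by fastforce
qed

lemma Cc_borel_measurable: "f \<in> Cc \<Longrightarrow> f \<in> borel_measurable borel"
  by (simp add: Cc_def borel_measurable_continuous_onI)

lemma Cc_bounded:
  assumes "f \<in> Cc"
  obtains B where "0 \<le> B" "\<And>x. \<bar>f x\<bar> \<le> B"
proof -
  let ?K = "closure {x. f x \<noteq> 0}"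
  have "compact (f ` ?K)"
    using assms by (auto simp: Cc_def intro: compact_continuous_image continuous_on_subset)
  then obtain B where B: "\<And>y. y \<in> f ` ?K \<Longrightarrow> \<bar>y\<bar> \<le> B"
    using compact_imp_bounded bounded_iff by (metis real_norm_def)
  have "\<bar>f x\<bar> \<le> max B 0" for x
  proof (cases "f x = 0")
    case False
    then have "x \<in> ?K" using closure_subset[of "{x. f x \<noteq> 0}"] by auto
    then show ?thesis using B by fastforce
  qed simp
  then show thesis using that[of "max B 0"] by simp
qed

lemma Cc_nn_integral_finite:
  fixes M :: "'a::t2_space measure"
  assumes "sets M = sets borel" "\<And>K. compact K \<Longrightarrow> emeasure M K < \<infinity>" "f \<in> Cc"
  shows "(\<integral>\<^sup>+x. ennreal \<bar>f x\<bar> \<partial>M) < \<infinity>"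
proof -
  let ?K = "closure {x. f x \<noteq> 0}"
  obtain B where B: "0 \<le> B" "\<And>x. \<bar>f x\<bar> \<le> B" using Cc_bounded[OF assms(3)] by blast
  have K: "compact ?K" using assms(3) by (simp add: Cc_def)
  have "(\<integral>\<^sup>+x. ennreal \<bar>f x\<bar> \<partial>M) \<le> (\<integral>\<^sup>+x. ennreal B * indicator ?K x \<partial>M)"
  proof (intro nn_integral_mono)
    fix x
    have "x \<in> ?K" if "f x \<noteq> 0"
      by (rule subsetD[OF closure_subset]) (use that in simp)
    then show "ennreal \<bar>f x\<bar> \<le> ennreal B * indicator ?K x"
      using B(2)[of x] by (cases "f x = 0") (simp_all add: ennreal_leI)
  qed
  also have "\<dots> = ennreal B * emeasure M ?K"
    by (intro nn_integral_cmult_indicator) (auto simp: assms(1))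
  also have "\<dots> < \<infinity>"
    using assms(2)[OF K] by (auto simp: ennreal_mult_less_top)
  finally show ?thesis .
qed

lemma Cc_integrable:
  fixes M :: "'a::t2_space measure"
  assumes "sets M = sets borel" "\<And>K. compact K \<Longrightarrow> emeasure M K < \<infinity>" "f \<in> Cc"
  shows "integrable M f"
  using Cc_nn_integral_finite[OF assms] Cc_borel_measurable[OF assms(3)]
  by (simp add: integrable_iff_bounded measurable_cong_sets[OF assms(1) refl])

lemma radon_measureD:
  assumes "radon_measure M"
  shows "sets M = sets borel"
    and "compact K \<Longrightarrow> emeasure M K < \<infinity>"
    and "A \<in> sets borel \<Longrightarrow> emeasure M A = (INF U\<in>{U. open U \<and> A \<subseteq> U}. emeasure M U)"
    and "open U \<Longrightarrow> emeasure M U = (SUP K\<in>{K. compact K \<and> K \<subseteq> U}. emeasure M K)"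
proof -
  note * = assms[unfolded radon_measure_def]
  show "sets M = sets borel" using * by (rule conjunct1)
  show "compact K \<Longrightarrow> emeasure M K < \<infinity>"
    using *[THEN conjunct2, THEN conjunct1] by simp
  show "A \<in> sets borel \<Longrightarrow> emeasure M A = (INF U\<in>{U. open U \<and> A \<subseteq> U}. emeasure M U)"
    by (rule *[THEN conjunct2, THEN conjunct2, THEN conjunct1, THEN bspec])
  show "open U \<Longrightarrow> emeasure M U = (SUP K\<in>{K. compact K \<and> K \<subseteq> U}. emeasure M K)"
    by (rule *[THEN conjunct2, THEN conjunct2, THEN conjunct2, THEN spec, THEN mp])
qed

text \<open>A test function squeezed between the indicators of \<open>K\<close> and \<open>U\<close>
  compares the two measures on these sets. Inner regularity then gives equality on open sets, and
  outer regularity on Borel sets.\<close>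

lemma radon_measure_unique:
  fixes M N :: "'a::{t2_space, second_countable_topology} measure"
  assumes lc: "locally_compact_space (euclidean :: 'a topology)"
    and M: "radon_measure M" and N: "radon_measure N"
    and eq: "\<And>f. f \<in> Cc \<Longrightarrow> (\<integral>x. f x \<partial>M) = (\<integral>x. f x \<partial>N)"
  shows "M = N"
proof -
  have le: "emeasure M1 U \<le> emeasure M2 U"
    if M1: "radon_measure M1" and M2: "radon_measure M2" and U: "open U"
      and eq: "\<And>f. f \<in> Cc \<Longrightarrow> (\<integral>x. f x \<partial>M1) = (\<integral>x. f x \<partial>M2)"
    for M1 M2 :: "'a measure" and U
  proof -
    have s: "sets M1 = sets borel" "sets M2 = sets borel"
      using M1 M2 by (auto dest: radon_measureD(1))
    have "emeasure M1 K \<le> emeasure M2 U" if K: "compact K" "K \<subseteq> U" for K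
    proof -
      obtain f where f: "f \<in> Cc" "\<And>x. 0 \<le> f x" "\<And>x. f x \<le> 1" "\<And>x. x \<in> K \<Longrightarrow> f x = 1" "\<And>x. x \<notin> U \<Longrightarrow> f x = 0"
        by (rule Cc_Urysohn[OF lc K U]) blast
      have nn: "(\<integral>\<^sup>+x. f x \<partial>M') = ennreal (\<integral>x. f x \<partial>M')" if "radon_measure M'" for M' :: "'a measure"
        using that f(1,2) by (intro nn_integral_eq_integral Cc_integrable) (auto dest: radon_measureD)
      have "emeasure M1 K = (\<integral>\<^sup>+x. indicator K x \<partial>M1)"
        using K by (simp add: s compact_imp_closed)
      also have "\<dots> \<le> (\<integral>\<^sup>+x. f x \<partial>M1)"
        by (intro nn_integral_mono) (auto simp: indicator_def f(4))
      also have "\<dots> = (\<integral>\<^sup>+x. f x \<partial>M2)"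
        using nn[OF M1] nn[OF M2] eq[OF f(1)] by simp
      also have "\<dots> \<le> (\<integral>\<^sup>+x. indicator U x \<partial>M2)"
        using f(3) by (intro nn_integral_mono) (auto simp: indicator_def f(5))
      also have "\<dots> = emeasure M2 U"
        using U by (simp add: s)
      finally show ?thesis .
    qed
    then show ?thesis
      unfolding radon_measureD(4)[OF M1 U] by (intro SUP_least) simp
  qed
  have op: "emeasure M U = emeasure N U" if "open U" for U
    by (rule antisym[OF le[OF M N that eq] le[OF N M that eq[symmetric]]])
  show ?thesis
  proof (rule measure_eqI)
    show "sets M = sets N" using M N by (simp add: radon_measureD(1))
    fix A assume "A \<in> sets M"
    then have A: "A \<in> sets borel" using M by (simp add: radon_measureD(1))
    show "emeasure M A = emeasure N A"
      unfolding radon_measureD(3)[OF M A] radon_measureD(3)[OF N A] by (rule INF_cong) (use op in auto)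
  qed
qed

subsection \<open>Separated sets\<close>

definition separated_by :: "'a::group_add set \<Rightarrow> 'a set \<Rightarrow> bool" where
  "separated_by D A \<longleftrightarrow> (\<forall>x\<in>A. \<forall>y\<in>A. - x + y \<in> D \<longrightarrow> x = y)"

lemma separated_byD: "separated_by D A \<Longrightarrow> x \<in> A \<Longrightarrow> y \<in> A \<Longrightarrow> - x + y \<in> D \<Longrightarrow> x = y"
  by (simp add: separated_by_def)

lemma separated_by_subset: "separated_by D B \<Longrightarrow> A \<subseteq> B \<Longrightarrow> separated_by D A"
  by (auto simp: separated_by_def)

lemma mem_left_translate: "x \<in> g +o A \<longleftrightarrow> - g + x \<in> A" for x :: "'a::group_add"
proof
  assume "- g + x \<in> A"
  then have "g + (- g + x) \<in> g +o A" by (rule set_plus_intro2)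
  then show "x \<in> g +o A" by simp
qed (auto simp: elt_set_plus_def)

lemma left_translate_diff: "- (g + x) + (g + y) = - x + y" for x :: "'a::group_add"
  by (simp add: minus_add add.assoc del: add_uminus_conv_diff)

lemma separated_by_left_translate: "separated_by D A \<Longrightarrow> separated_by D (g +o A)"
  by (auto simp: separated_by_def elt_set_plus_def left_translate_diff)

lemma diff_set_eq: "uminus ` X + X = {- x + y | x y. x \<in> X \<and> y \<in> X}" for X :: "'a::group_add set"
  by (auto simp: set_plus_def)

lemma diff_set_subset_iff:
  "uminus ` X + X \<subseteq> D \<longleftrightarrow> (\<forall>x\<in>X. \<forall>y\<in>X. - x + y \<in> D)" for X :: "'a::group_add set"
  by (auto simp: set_plus_def)

lemma diff_set_left_translate: "uminus ` (g +o X) + (g +o X) = uminus ` X + X" for X :: "'a::group_add set"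
proof (intro equalityI)
  show "uminus ` (g +o X) + (g +o X) \<subseteq> uminus ` X + X"
    unfolding diff_set_subset_iff
  proof (intro ballI)
    fix x y assume "x \<in> g +o X" "y \<in> g +o X"
    then obtain a b where "a \<in> X" "b \<in> X" "x = g + a" "y = g + b"
      by (auto simp: elt_set_plus_def)
    then show "- x + y \<in> uminus ` X + X"
      by (simp only: left_translate_diff) (intro set_plus_intro imageI)
  qed
  have "- x + y \<in> uminus ` (g +o X) + (g +o X)" if "x \<in> X" "y \<in> X" for x y
    unfolding left_translate_diff[of g x y, symmetric]
    using that by (intro set_plus_intro imageI set_plus_intro2)
  then show "uminus ` X + X \<subseteq> uminus ` (g +o X) + (g +o X)"
    unfolding diff_set_subset_iff by blast
qed

text \<open>The basic interplay of packings and hulls: differences of points of \<open>X\<close> lie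
  in \<open>D\<close>, which separation of \<open>A\<close> forbids for distinct points.\<close>

lemma subsingleton_Int_separated:
  assumes "uminus ` X + X \<subseteq> D" "separated_by D A" "x \<in> X \<inter> A" "y \<in> X \<inter> A"
  shows "x = y"
  using assms unfolding diff_set_subset_iff by (intro separated_byD[of D A]) auto

lemma finite_subsingleton: "(\<And>x y. x \<in> A \<Longrightarrow> y \<in> A \<Longrightarrow> x = y) \<Longrightarrow> finite A"
  by (metis finite.emptyI finite_insert finite_subset insertI1 subsetI)

lemma emeasure_count_subsingleton_le:
  assumes "\<And>x y. x \<in> A \<Longrightarrow> y \<in> A \<Longrightarrow> x = y"
  shows "emeasure (count_space UNIV) A \<le> 1"
proof (cases "A = {}")
  case False
  then obtain x where "x \<in> A" by blast
  then have "A = {x}" using assms by blast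
  then show ?thesis by simp
qed simp

lemma open_left_translate:
  fixes A :: "'a::topological_group_add set"
  assumes "open A" shows "open (g +o A)"
proof -
  have "g +o A = (\<lambda>x. - g + x) -` A"
    by (auto simp: mem_left_translate)
  then show ?thesis
    using assms by (simp add: open_vimage continuous_intros)
qed

lemma right_translate_borel:
  fixes A :: "'a::topological_group_add set"
  assumes "A \<in> sets borel" shows "(\<lambda>x. x + g) ` A \<in> sets borel"
proof -
  have "(\<lambda>x. x + - g) \<in> borel_measurable borel"
    by (intro borel_measurable_continuous_onI continuous_intros)
  then have "(\<lambda>x. x + - g) -` A \<inter> space borel \<in> sets borel"
    using assms by (rule measurable_sets)
  moreover have "(\<lambda>x. x + - g) -` A = (\<lambda>x. x + g) ` A"
    by (auto simp: image_iff add.assoc intro!: bexI[of _ "_ + - g"])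
  ultimately show ?thesis by simp
qed

lemma set_plus_borel:
  fixes A :: "'a::topological_group_add set"
  assumes "A \<in> sets borel" "countable B" shows "A + B \<in> sets borel"
proof -
  have "A + B = (\<Union>b\<in>B. (\<lambda>x. x + b) ` A)"
    by (auto simp: set_plus_def)
  then show ?thesis
    using assms by (auto intro!: sets.countable_UN' right_translate_borel)
qed

section \<open>The Chabauty-Fell topology\<close>

lemma topspace_chabauty_fell: "topspace (chabauty_fell :: 'a::topological_space set topology) = {F. closed F}"
proof (rule equalityI)
  show "topspace chabauty_fell \<subseteq> {F :: 'a set. closed F}"
    unfolding chabauty_fell_def topology_generated_by_topspace by blast
  \<comment> \<open>Avoiding the empty compact set is no restriction, so one generator already
    contains every closed set.\<close>
  have "{F :: 'a set. closed F \<and> F \<inter> {} = {}} \<subseteq> topspace chabauty_fell"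
    unfolding chabauty_fell_def topology_generated_by_topspace using compact_empty by blast
  then show "{F :: 'a set. closed F} \<subseteq> topspace chabauty_fell" by simp
qed

lemma openin_hit: "open W \<Longrightarrow> openin chabauty_fell {F :: 'a::topological_space set. closed F \<and> F \<inter> W \<noteq> {}}"
  unfolding chabauty_fell_def by (rule topology_generated_by_Basis) blast


subsection \<open>The difference set of a uniformly discrete approximate subgroup\<close>

locale discrete_approximate_subgroup =
  fixes \<Lambda> :: "'a::{topological_group_add, t2_space, second_countable_topology} set"
  assumes lc: "locally_compact_space (euclidean :: 'a topology)"
    and approx: "approximate_subgroup \<Lambda>"
    and ud: "uniformly_discrete \<Lambda>"
begin

abbreviation "D \<equiv> uminus ` \<Lambda> + \<Lambda>"

lemma zero_mem: "0 \<in> \<Lambda>" and uminus_image: "uminus ` \<Lambda> = \<Lambda>"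
  using approx by (auto simp: approximate_subgroup_def)

lemma uminus_mem: "x \<in> \<Lambda> \<Longrightarrow> - x \<in> \<Lambda>"
  using uminus_image by blast

lemma D_eq: "D = \<Lambda> + \<Lambda>"
  by (simp add: uminus_image)

lemma zero_mem_D: "0 \<in> D"
  using set_plus_intro[OF zero_mem zero_mem] by (simp add: D_eq)

lemma uminus_mem_D: "x \<in> D \<Longrightarrow> - x \<in> D"
  unfolding diff_set_eq by (auto simp: minus_add simp del: add_uminus_conv_diff) blast

text \<open>\<open>D\<close> meets some open \<open>U\<close> only in 0, and continuity of
  \<open>- x + y\<close> at the origin gives a neighbourhood whose differences all lie in
  \<open>U\<close>.\<close>

lemma separated_nhd: "\<exists>V. open V \<and> 0 \<in> V \<and> separated_by D V"
proof -
  obtain U where U: "open U" "D \<inter> U = {0}"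
    using ud by (auto simp: uniformly_discrete_def)
  let ?f = "\<lambda>p::'a\<times>'a. - fst p + snd p"
  have "open (?f -` U)"
    using U(1) by (intro open_vimage continuous_intros)
  moreover have "(0, 0) \<in> ?f -` U"
    using U(2) by auto
  ultimately obtain A B where AB: "open A" "open B" "(0, 0) \<in> A \<times> B" "A \<times> B \<subseteq> ?f -` U"
    by (rule open_prod_elim)
  have "separated_by D (A \<inter> B)"
    unfolding separated_by_def
  proof (intro ballI impI)
    fix x y assume *: "x \<in> A \<inter> B" "y \<in> A \<inter> B" "- x + y \<in> D"
    then have "- x + y \<in> U" using AB(4) by auto
    then have "- x + y = 0" using * U(2) by blast
    then show "x = y" by (simp add: neg_eq_iff_add_eq_0[symmetric])
  qed
  then show ?thesis
    using AB by (intro exI[of _ "A \<inter> B"]) auto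
qed

text \<open>Fixed once and for all: its translates are the windows in which every \<open>X\<close>
  with differences in \<open>D\<close> has at most one point.\<close>

definition V :: "'a set" where "V = (SOME V. open V \<and> 0 \<in> V \<and> separated_by D V)"

lemma open_V: "open V" and zero_mem_V: "0 \<in> V" and separated_V: "separated_by D V"
  using someI_ex[OF separated_nhd] by (auto simp: V_def)

lemma open_translate_V: "open (g +o V)" and mem_translate_V: "g \<in> g +o V"
  and separated_translate_V: "separated_by D (g +o V)"
  using open_V zero_mem_V separated_V
  by (auto simp: open_left_translate mem_left_translate separated_by_left_translate)

lemma finite_Int_translate_V: "uminus ` X + X \<subseteq> D \<Longrightarrow> finite (X \<inter> (g +o V))"
  by (rule finite_subsingleton) (rule subsingleton_Int_separated[OF _ separated_translate_V])

text \<open>A point outside \<open>X\<close> has a window containing at most one point of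
  \<open>X\<close>; deleting that point leaves an open neighbourhood that misses
  \<open>X\<close>.\<close>

lemma closed_if_diff_set: assumes "uminus ` X + X \<subseteq> D" shows "closed X"
proof -
  have "\<exists>T. open T \<and> x \<in> T \<and> T \<subseteq> - X" if "x \<notin> X" for x
    using that finite_Int_translate_V[OF assms, of x] mem_translate_V[of x]
    by (intro exI[of _ "(x +o V) - (X \<inter> (x +o V))"]) (auto intro!: open_Diff open_translate_V finite_imp_closed)
  then show ?thesis
    unfolding closed_def by (subst open_subopen) blast
qed

text \<open>Second countability reduces the windows to a sequence, whose order drives both the
  greedy construction and the disjoint partition used for counting.\<close>

definition center :: "nat \<Rightarrow> 'a" where "center = (SOME c. (\<Union>n. c n +o V) = UNIV)"

lemma UN_center: "(\<Union>n. center n +o V) = UNIV"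
proof -
  obtain s' :: "nat \<Rightarrow> 'a" where "UNIV \<subseteq> (\<Union>n. s' n +o V)"
    by (rule countable_open_subcover[of UNIV "\<lambda>g. g +o V"]) (auto simp: open_translate_V mem_translate_V)
  then have "\<exists>s :: nat \<Rightarrow> 'a. (\<Union>n. s n +o V) = UNIV" by blast
  from someI_ex[OF this] show ?thesis unfolding center_def .
qed

lemma countable_if_diff_set: assumes "uminus ` X + X \<subseteq> D" shows "countable X"
proof -
  have "X = (\<Union>n. X \<inter> (center n +o V))"
    using UN_center by blast
  moreover have "countable (\<Union>n. X \<inter> (center n +o V))"
    using finite_Int_translate_V[OF assms] by (intro countable_UN) (auto intro: countable_finite)
  ultimately show ?thesis by simp
qed

lemma compact_cover:
  assumes "compact K" obtains T where "finite T" "K \<subseteq> (\<Union>g\<in>T. g +o V)"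
proof -
  obtain T where "T \<subseteq> UNIV" "finite T" "K \<subseteq> (\<Union>g\<in>T. g +o V)"
    using compactE_image[OF assms, of UNIV "\<lambda>g. g +o V"] open_translate_V mem_translate_V by blast
  then show thesis using that by blast
qed

lemma finite_Int_compact:
  assumes "uminus ` X + X \<subseteq> D" "compact K" shows "finite (X \<inter> K)"
proof -
  obtain T where T: "finite T" "K \<subseteq> (\<Union>g\<in>T. g +o V)"
    using compact_cover[OF assms(2)] .
  have "finite (\<Union>g\<in>T. X \<inter> (g +o V))"
    using T(1) finite_Int_translate_V[OF assms(1)] by blast
  then show ?thesis
    by (rule finite_subset[rotated]) (use T(2) in blast)
qed

lemma closed_\<Lambda>: "closed \<Lambda>" and countable_\<Lambda>: "countable \<Lambda>"
  by (simp_all add: closed_if_diff_set countable_if_diff_set)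

text \<open>Only those \<open>f\<close> matter whose translate \<open>f +o \<Lambda>\<close> meets
  \<open>\<Lambda> + \<Lambda>\<close>, and such an \<open>f\<close> lies in the triple sum. This
  location of \<open>F\<close> is what later bounds the orbit counts of
  \<open>E + T\<close>.\<close>

lemma \<Lambda>_cover: "\<exists>F. finite F \<and> F \<subseteq> \<Lambda> + \<Lambda> + \<Lambda> \<and> \<Lambda> + \<Lambda> \<subseteq> F + \<Lambda>"
proof -
  obtain F where F: "finite F" "\<Lambda> + \<Lambda> \<subseteq> F + \<Lambda>"
    using approx by (auto simp: approximate_subgroup_def)
  have "\<Lambda> + \<Lambda> \<subseteq> (F \<inter> (\<Lambda> + \<Lambda> + \<Lambda>)) + \<Lambda>"
  proof
    fix x assume x: "x \<in> \<Lambda> + \<Lambda>"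
    then have "x \<in> F + \<Lambda>" using F(2) by blast
    then obtain f l where fl: "f \<in> F" "l \<in> \<Lambda>" "x = f + l"
      by (auto elim: set_plus_elim)
    have "x + - l \<in> \<Lambda> + \<Lambda> + \<Lambda>"
      using x uminus_mem[OF fl(2)] by (rule set_plus_intro)
    then show "x \<in> (F \<inter> (\<Lambda> + \<Lambda> + \<Lambda>)) + \<Lambda>"
      using fl by (auto simp: add.assoc)
  qed
  then show ?thesis
    using F(1) by (intro exI[of _ "F \<inter> (\<Lambda> + \<Lambda> + \<Lambda>)"]) auto
qed

text \<open>Differences of elements of \<open>D\<close> need not lie in \<open>D\<close>, but
  \<open>D\<close> is covered by finitely many translates of \<Lambda>, and differences inside each
  of these pieces do.\<close>

lemma closed_D: "closed D" and countable_D: "countable D"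
proof -
  obtain F where F: "finite F" "D \<subseteq> F + \<Lambda>"
    using approx by (auto simp: approximate_subgroup_def D_eq)
  have eq: "D = (\<Union>f\<in>F. D \<inter> (f +o \<Lambda>))"
    using F(2) by (auto simp: set_plus_def elt_set_plus_def)
  have *: "uminus ` (D \<inter> (f +o \<Lambda>)) + (D \<inter> (f +o \<Lambda>)) \<subseteq> D" for f
    using set_plus_mono2[of "uminus ` (D \<inter> (f +o \<Lambda>))" "uminus ` (f +o \<Lambda>)" "D \<inter> (f +o \<Lambda>)" "f +o \<Lambda>"]
    unfolding diff_set_left_translate by blast
  have "closed (\<Union>f\<in>F. D \<inter> (f +o \<Lambda>))"
    using closed_if_diff_set[OF *] F(1) by blast
  then show "closed D" by (simp only: eq[symmetric])
  have "countable (\<Union>f\<in>F. D \<inter> (f +o \<Lambda>))"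
    using countable_if_diff_set[OF *] F(1) by (intro countable_UN) (auto intro: countable_finite)
  then show "countable D" by (simp only: eq[symmetric])
qed

section \<open>Hulls in terms of difference sets\<close>

lemma ext_invariant_hull_eq: "ext_invariant_hull \<Lambda> = {X. uminus ` X + X \<subseteq> D}"
  using closed_D closed_if_diff_set by (auto simp: ext_invariant_hull_def)

text \<open>Having all differences in the closed set \<open>D\<close> is a closed condition: if
  \<open>- x + y\<close> escapes \<open>D\<close>, so do all differences from some \<open>A\<close>
  around \<open>x\<close> to some \<open>B\<close> around \<open>y\<close>, and no translate of
  \<Lambda> hits both \<open>A\<close> and \<open>B\<close>.\<close>

lemma invariant_hull_subset: "invariant_hull \<Lambda> \<subseteq> ext_invariant_hull \<Lambda>"
proof
  fix X assume X: "X \<in> invariant_hull \<Lambda>"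
  then have cX: "closed X"
    using closure_of_subset_topspace[of chabauty_fell] topspace_chabauty_fell
    by (auto simp: invariant_hull_def)
  have "- x + y \<in> D" if xy: "x \<in> X" "y \<in> X" for x y
  proof (rule ccontr)
    assume neg: "- x + y \<notin> D"
    let ?f = "\<lambda>p::'a\<times>'a. - fst p + snd p"
    have "open (?f -` (- D))"
      using closed_D by (intro open_vimage continuous_intros) (auto simp: closed_def)
    moreover have "(x, y) \<in> ?f -` (- D)"
      using neg by auto
    ultimately obtain A B where AB: "open A" "open B" "(x, y) \<in> A \<times> B" "A \<times> B \<subseteq> ?f -` (- D)"
      by (rule open_prod_elim)
    let ?N = "{F. closed F \<and> F \<inter> A \<noteq> {}} \<inter> {F. closed F \<and> F \<inter> B \<noteq> {}}"
    have "openin chabauty_fell ?N"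
      using AB by (intro openin_Int openin_hit)
    moreover have "X \<in> ?N"
      using cX xy AB(3) by auto
    moreover have "\<forall>T. X \<in> T \<and> openin chabauty_fell T \<longrightarrow> (\<exists>y\<in>range (\<lambda>g. g +o \<Lambda>). y \<in> T)"
      using X by (auto simp: invariant_hull_def in_closure_of)
    ultimately have "\<exists>y\<in>range (\<lambda>g. g +o \<Lambda>). y \<in> ?N"
      by presburger
    then obtain g where "g +o \<Lambda> \<in> ?N"
      by (elim bexE rangeE) simp
    then obtain a b where ab: "a \<in> g +o \<Lambda>" "a \<in> A" "b \<in> g +o \<Lambda>" "b \<in> B"
      by blast
    have "- a + b \<in> D"
      using ab(1,3) diff_set_left_translate[of g \<Lambda>] by blast
    then show False using AB(4) ab by auto
  qed
  then show "X \<in> ext_invariant_hull \<Lambda>"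
    unfolding ext_invariant_hull_eq diff_set_subset_iff by blast
qed

lemma hull_diff_set: "X \<in> invariant_hull \<Lambda> \<Longrightarrow> uminus ` X + X \<subseteq> D"
  using invariant_hull_subset by (auto simp: ext_invariant_hull_eq)

section \<open>A maximal Borel packing\<close>

primrec greedy :: "nat \<Rightarrow> 'a set" where
  "greedy 0 = {}"
| "greedy (Suc n) = greedy n \<union> ((center n +o V) - (greedy n + D))"

lemma greedy_borel: "greedy n \<in> sets borel"
proof (induction n)
  case (Suc n)
  then show ?case
    using set_plus_borel[OF Suc countable_D] borel_open[OF open_translate_V, of "center n"]
    by (simp only: greedy.simps) (intro sets.Un sets.Diff)
qed simp

text \<open>A difference between an old and a new point avoids \<open>D\<close> by construction, in
  both orders because \<open>D\<close> is symmetric; two new points share a window.\<close>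

lemma greedy_separated: "separated_by D (greedy n)"
proof (induction n)
  case (Suc n)
  have new: "- x + y \<notin> D" if "x \<in> greedy n" "y \<notin> greedy n + D" for x y
    using that set_plus_intro[of x "greedy n" "- x + y" D] by auto
  show ?case
    unfolding separated_by_def
  proof (intro ballI impI)
    fix x y assume xy: "x \<in> greedy (Suc n)" "y \<in> greedy (Suc n)" "- x + y \<in> D"
    have "- y + x \<in> D"
      using uminus_mem_D[OF xy(3)] by (simp add: minus_add)
    with new[of x y] new[of y x] xy
    have "x \<in> greedy n \<and> y \<in> greedy n \<or> x \<in> center n +o V \<and> y \<in> center n +o V"
      by auto
    then show "x = y"
      using separated_byD[OF Suc] separated_byD[OF separated_translate_V] xy(3) by blast
  qed
qed (simp add: separated_by_def)

text \<open>A point of the \<open>n\<close>-th window either lies in \<open>greedy n + D\<close>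
  already or is added at the next stage, where \<open>0 \<in> D\<close> covers it. The windows
  exhaust the group.\<close>

lemma maximal_packing: "\<exists>E. E \<in> sets borel \<and> separated_by D E \<and> E + D = UNIV"
proof (intro exI conjI)
  have mono: "greedy m \<subseteq> greedy n" if "m \<le> n" for m n
    using that by (rule lift_Suc_mono_le[rotated]) auto
  show "(\<Union>n. greedy n) \<in> sets borel"
    using greedy_borel by blast
  show "separated_by D (\<Union>n. greedy n)"
    unfolding separated_by_def
  proof (intro ballI impI)
    fix x y assume "x \<in> (\<Union>n. greedy n)" "y \<in> (\<Union>n. greedy n)" and xy: "- x + y \<in> D"
    then obtain m n where "x \<in> greedy m" "y \<in> greedy n" by blast
    then have "x \<in> greedy (max m n)" "y \<in> greedy (max m n)"
      using mono[of m "max m n"] mono[of n "max m n"] by auto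
    then show "x = y" using separated_byD[OF greedy_separated] xy by blast
  qed
  have "x \<in> (\<Union>n. greedy n) + D" for x
  proof -
    obtain n where n: "x \<in> center n +o V" using UN_center by blast
    show ?thesis
    proof (cases "x \<in> greedy n + D")
      case True
      then show ?thesis
        using set_plus_mono2[of "greedy n" "\<Union>n. greedy n" D D] by blast
    next
      case False
      then have "x \<in> greedy (Suc n)" using n by simp
      then have "x + 0 \<in> (\<Union>n. greedy n) + D"
        by (intro set_plus_intro zero_mem_D) blast
      then show ?thesis by simp
    qed
  qed
  then show "(\<Union>n. greedy n) + D = UNIV" by blast
qed

section \<open>The orbit map into the hull\<close>

lemma closed_left_translate: "closed (g +o \<Lambda>)"
  by (rule closed_if_diff_set) (simp add: diff_set_left_translate)

lemma orbit_mem_hull: "g +o \<Lambda> \<in> invariant_hull \<Lambda>"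
proof -
  have "range (\<lambda>g. g +o \<Lambda>) \<subseteq> topspace chabauty_fell"
    by (auto simp: topspace_chabauty_fell closed_left_translate)
  then have "range (\<lambda>g. g +o \<Lambda>) \<subseteq> invariant_hull \<Lambda>"
    unfolding invariant_hull_def by (rule closure_of_subset)
  then show ?thesis by blast
qed

lemma continuous_orbit: "continuous_map euclidean chabauty_fell (\<lambda>g. g +o \<Lambda>)"
proof -
  note cl = closed_left_translate
  \<comment> \<open>Hitting \<open>W\<close> means that \<open>g + l\<close> lies in
    \<open>W\<close> for some \<open>l\<close> in \<Lambda>, a union of open conditions.\<close>
  have hit: "open {g. (g +o \<Lambda>) \<inter> W \<noteq> {}}" if "open W" for W
  proof -
    have "{g. (g +o \<Lambda>) \<inter> W \<noteq> {}} = (\<Union>l\<in>\<Lambda>. (\<lambda>g. g + l) -` W)"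
      by (auto simp: elt_set_plus_def)
    moreover have "open ((\<lambda>g. g + l) -` W)" for l
      using that by (intro open_vimage continuous_intros)
    ultimately show ?thesis by auto
  qed
  \<comment> \<open>Closedness of \<Lambda> makes missing a single point of \<open>K\<close> an open
    condition; compactness of \<open>K\<close> makes it hold for all of \<open>K\<close> near
    \<open>g0\<close>, by the tube lemma.\<close>
  have miss: "open {g. (g +o \<Lambda>) \<inter> K = {}}" if K: "compact K" for K
  proof (subst open_subopen, intro ballI)
    fix g0 assume "g0 \<in> {g. (g +o \<Lambda>) \<inter> K = {}}"
    then have g0: "(g0 +o \<Lambda>) \<inter> K = {}" by simp
    let ?W = "(\<lambda>p::'a\<times>'a. - fst p + snd p) -` (- \<Lambda>)"
    have W: "open ?W"
      using closed_\<Lambda> by (intro open_vimage continuous_intros) (auto simp: closed_def)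
    have "{g0} \<times> K \<subseteq> ?W"
      using g0 by (auto simp: mem_left_translate)
    then obtain A where A: "g0 \<in> A" "open A" "A \<times> K \<subseteq> ?W"
      using Elementary_Topology.tube_lemma[OF K W] by blast
    then have "A \<subseteq> {g. (g +o \<Lambda>) \<inter> K = {}}"
      by (auto simp: mem_left_translate)
    then show "\<exists>T. open T \<and> g0 \<in> T \<and> T \<subseteq> {g. (g +o \<Lambda>) \<inter> K = {}}"
      using A by blast
  qed
  show ?thesis
    unfolding chabauty_fell_def
  proof (rule continuous_on_generated_topo)
    fix U :: "'a set set"
    assume "U \<in> {{F. closed F \<and> F \<inter> V \<noteq> {}} | V. open V} \<union> {{F. closed F \<and> F \<inter> K = {}} | K. compact K}"
    then show "openin euclidean ((\<lambda>g. g +o \<Lambda>) -` U \<inter> topspace euclidean)"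
      using cl hit miss by auto
  next
    show "(\<lambda>g. g +o \<Lambda>) ` topspace euclidean \<subseteq> \<Union>({{F. closed F \<and> F \<inter> V \<noteq> {}} | V. open V} \<union> {{F. closed F \<and> F \<inter> K = {}} | K. compact K})"
      using cl topspace_chabauty_fell unfolding chabauty_fell_def topology_generated_by_topspace by auto
  qed
qed

end

subsection \<open>The intensity measure of a probability measure on the hull\<close>

text \<open>Counting with values in \<open>ennreal\<close> admits infinite sets and gives countable
  additivity without summability conditions.\<close>

abbreviation point_count :: "'a set \<Rightarrow> ennreal" where "point_count \<equiv> emeasure (count_space UNIV)"

lemma nn_integral_count_space_indicator_set:
  "(\<integral>\<^sup>+x. indicator A x \<partial>count_space X) = point_count (X \<inter> A)"
proof -
  have "(\<integral>\<^sup>+x. indicator A x \<partial>count_space X) = (\<integral>\<^sup>+x. indicator A x * indicator X x \<partial>count_space UNIV)"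
    by (rule nn_integral_count_space_indicator) (simp add: NO_MATCH_def)
  also have "\<dots> = (\<integral>\<^sup>+x. indicator (X \<inter> A) x \<partial>count_space UNIV)"
    by (intro nn_integral_cong) (auto split: split_indicator)
  finally show ?thesis by simp
qed

lemma point_count_disjoint_UN:
  fixes A :: "nat \<Rightarrow> 'a set"
  assumes "disjoint_family A" shows "point_count (\<Union>n. A n) = (\<Sum>n. point_count (A n))"
  using suminf_emeasure[of A "count_space UNIV"] assms by simp

locale hull_measure = discrete_approximate_subgroup \<Lambda>
  for \<Lambda> :: "'a::{topological_group_add, t2_space, second_countable_topology} set" +
  fixes \<nu> :: "'a set measure"
  assumes \<nu>: "borel_prob_on_hull \<Lambda> \<nu>"
begin

sublocale prob_space \<nu>
  using \<nu> by (simp add: borel_prob_on_hull_def)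

lemma space_\<nu>: "space \<nu> = invariant_hull \<Lambda>"
proof -
  have "invariant_hull \<Lambda> \<subseteq> topspace chabauty_fell"
    unfolding invariant_hull_def by (rule closure_of_subset_topspace)
  then show ?thesis
    using \<nu> sets_eq_imp_space_eq[of \<nu>]
    by (auto simp: borel_prob_on_hull_def borel_of_topology_def space_measure_of_conv)
qed

section \<open>Measurability of point counts\<close>

lemma openin_sets_\<nu>:
  assumes "openin chabauty_fell U" shows "U \<inter> invariant_hull \<Lambda> \<in> sets \<nu>"
proof -
  let ?T = "subtopology chabauty_fell (invariant_hull \<Lambda>)"
  have "{U. openin ?T U} \<subseteq> Pow (topspace ?T)"
    using openin_subset by blast
  then have "sets \<nu> = sigma_sets (topspace ?T) {U. openin ?T U}"
    using \<nu> by (simp add: borel_prob_on_hull_def borel_of_topology_def)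
  moreover have "openin ?T (U \<inter> invariant_hull \<Lambda>)"
    using assms by (rule openin_subtopology_Int)
  ultimately show ?thesis by auto
qed

lemma hit_sets: assumes "open W" shows "{X \<in> space \<nu>. X \<inter> W \<noteq> {}} \<in> sets \<nu>"
proof -
  have "closed X" if "X \<in> invariant_hull \<Lambda>" for X
    by (rule closed_if_diff_set) (rule hull_diff_set[OF that])
  then have "{X \<in> space \<nu>. X \<inter> W \<noteq> {}} = {F. closed F \<and> F \<inter> W \<noteq> {}} \<inter> invariant_hull \<Lambda>"
    by (auto simp: space_\<nu>)
  then show ?thesis
    using openin_sets_\<nu>[OF openin_hit[OF assms]] by simp
qed

lemma point_count_le_1:
  assumes "X \<in> space \<nu>" "separated_by D A" shows "point_count (X \<inter> A) \<le> 1"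
proof (rule emeasure_count_subsingleton_le)
  have X: "uminus ` X + X \<subseteq> D"
    using assms(1) by (simp add: space_\<nu> hull_diff_set)
  show "x = y" if "x \<in> X \<inter> A" "y \<in> X \<inter> A" for x y
    using subsingleton_Int_separated[OF X assms(2) that] .
qed

text \<open>Inside one window the count is 0 or 1, hence the indicator of hitting an open set, which
  is an open condition on \<open>X\<close>.\<close>

lemma point_count_open_measurable:
  assumes "open W" shows "(\<lambda>X. point_count (X \<inter> (W \<inter> (g +o V)))) \<in> borel_measurable \<nu>"
proof -
  let ?W = "W \<inter> (g +o V)"
  have o: "open ?W" using assms open_translate_V by auto
  have "point_count (X \<inter> ?W) = indicator {X \<in> space \<nu>. X \<inter> ?W \<noteq> {}} X" if "X \<in> space \<nu>" for X
  proof (cases "X \<inter> ?W = {}")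
    case False
    then obtain x where "x \<in> X \<inter> ?W" by blast
    then have "point_count {x} \<le> point_count (X \<inter> ?W)"
      by (intro emeasure_mono) auto
    moreover have "point_count (X \<inter> ?W) \<le> 1"
      by (rule point_count_le_1[OF that separated_by_subset[OF separated_translate_V[of g]]]) simp
    ultimately show ?thesis
      using False that by simp
  qed simp
  then show ?thesis
    using hit_sets[OF o] by (subst measurable_cong) (auto intro: borel_measurable_indicator)
qed

text \<open>Induction from open to Borel sets. The window keeps the counts at most 1, so the
  subtraction in the complement case is legitimate in \<open>ennreal\<close>.\<close>

lemma point_count_piece_measurable:
  assumes "A \<in> sets borel" shows "(\<lambda>X. point_count (X \<inter> (A \<inter> (g +o V)))) \<in> borel_measurable \<nu>"
proof -
  have "Int_stable {S::'a set. open S}" "{S::'a set. open S} \<subseteq> Pow UNIV"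
    by (auto simp: Int_stable_def)
  moreover have "A \<in> sigma_sets UNIV {S. open S}"
    using assms by (simp add: sets_borel)
  ultimately show ?thesis
  proof (induction A rule: sigma_sets_induct_disjoint)
    case (basic A)
    then show ?case by (intro point_count_open_measurable) simp
  next
    case empty
    then show ?case by simp
  next
    case (compl A)
    have "point_count (X \<inter> ((UNIV - A) \<inter> (g +o V))) = point_count (X \<inter> (UNIV \<inter> (g +o V))) - point_count (X \<inter> (A \<inter> (g +o V)))"
      if "X \<in> space \<nu>" for X
    proof -
      have "point_count (X \<inter> (A \<inter> (g +o V))) \<le> 1"
        by (rule point_count_le_1[OF that separated_by_subset[OF separated_translate_V[of g]]]) simp
      then have "point_count (X \<inter> (A \<inter> (g +o V))) \<noteq> \<infinity>"
        using ennreal_one_less_top by (metis infinity_ennreal_def leD)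
      then have "point_count (X \<inter> (UNIV \<inter> (g +o V)) - X \<inter> (A \<inter> (g +o V))) = point_count (X \<inter> (UNIV \<inter> (g +o V))) - point_count (X \<inter> (A \<inter> (g +o V)))"
        by (intro emeasure_Diff) auto
      moreover have "X \<inter> (UNIV \<inter> (g +o V)) - X \<inter> (A \<inter> (g +o V)) = X \<inter> ((UNIV - A) \<inter> (g +o V))"
        by blast
      ultimately show ?thesis by simp
    qed
    moreover have "(\<lambda>X. point_count (X \<inter> (UNIV \<inter> (g +o V))) - point_count (X \<inter> (A \<inter> (g +o V)))) \<in> borel_measurable \<nu>"
      by (intro borel_measurable_minus_ennreal point_count_open_measurable compl.IH open_UNIV)
    ultimately show ?case
      by (subst measurable_cong) auto
  next
    case (union A)
    have "point_count (X \<inter> ((\<Union>i. A i) \<inter> (g +o V))) = (\<Sum>i. point_count (X \<inter> (A i \<inter> (g +o V))))" for X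
    proof -
      have "X \<inter> ((\<Union>i. A i) \<inter> (g +o V)) = (\<Union>i. X \<inter> (A i \<inter> (g +o V)))" by blast
      moreover have "disjoint_family (\<lambda>i. X \<inter> (A i \<inter> (g +o V)))"
        using union(1) by (auto simp: disjoint_family_on_def)
      ultimately show ?thesis
        by (simp only: point_count_disjoint_UN)
    qed
    then show ?case
      using union.IH by (simp add: borel_measurable_suminf_order)
  qed
qed

lemma point_count_measurable:
  assumes "A \<in> sets borel" shows "(\<lambda>X. point_count (X \<inter> A)) \<in> borel_measurable \<nu>"
proof -
  \<comment> \<open>Disjoint pieces of windows partition the group, so the count in \<open>A\<close>
    is a series of counts within windows.\<close>
  define W where "W = disjointed (\<lambda>n. center n +o V)"
  have W: "W n \<subseteq> center n +o V" "disjoint_family W" "(\<Union>n. W n) = UNIV" for n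
    using UN_center disjointed_subset[of "\<lambda>n. center n +o V" n]
    by (simp_all add: W_def disjoint_family_disjointed UN_disjointed_eq)
  have "range W \<subseteq> sets borel"
    unfolding W_def by (rule sets.range_disjointed_sets) (auto intro!: borel_open open_translate_V)
  then have Wb: "W n \<in> sets borel" for n by blast
  have "point_count (X \<inter> A) = (\<Sum>n. point_count (X \<inter> ((A \<inter> W n) \<inter> (center n +o V))))" for X
  proof -
    have "X \<inter> ((A \<inter> W n) \<inter> (center n +o V)) = X \<inter> A \<inter> W n" for n
      using W(1)[of n] by blast
    then have "X \<inter> A = (\<Union>n. X \<inter> ((A \<inter> W n) \<inter> (center n +o V)))"
      using W(3) by (simp only: Int_UN_distrib[symmetric]) simp
    moreover have "disjoint_family (\<lambda>n. X \<inter> ((A \<inter> W n) \<inter> (center n +o V)))"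
      using W(2) by (auto simp: disjoint_family_on_def)
    ultimately show ?thesis
      by (simp only: point_count_disjoint_UN)
  qed
  moreover have "(\<lambda>X. \<Sum>n. point_count (X \<inter> ((A \<inter> W n) \<inter> (center n +o V)))) \<in> borel_measurable \<nu>"
    using assms Wb by (intro borel_measurable_suminf_order point_count_piece_measurable) auto
  ultimately show ?thesis by simp
qed

section \<open>The intensity measure and Campbell's formula\<close>

definition intensity :: "'a measure" where
  "intensity = measure_of UNIV (sets borel) (\<lambda>A. \<integral>\<^sup>+X. point_count (X \<inter> A) \<partial>\<nu>)"

lemma sets_intensity: "sets intensity = sets borel"
  using sets.sigma_sets_eq[of "borel :: 'a measure"]
  by (simp add: intensity_def sets_measure_of_conv)

text \<open>\<open>measure_of\<close> yields the zero measure unless its set function is countably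
  additive; additivity comes from counting disjoint pieces and exchanging the series with the
  integral.\<close>

lemma emeasure_intensity:
  assumes "A \<in> sets borel" shows "emeasure intensity A = (\<integral>\<^sup>+X. point_count (X \<inter> A) \<partial>\<nu>)"
  unfolding intensity_def
proof (rule emeasure_measure_of_sigma)
  show "sigma_algebra UNIV (sets (borel :: 'a measure))"
    using sets.sigma_algebra_axioms[of "borel :: 'a measure"] by simp
  show "positive (sets borel) (\<lambda>A. \<integral>\<^sup>+X. point_count (X \<inter> A) \<partial>\<nu>)"
    by (simp add: positive_def)
  show "countably_additive (sets borel) (\<lambda>A. \<integral>\<^sup>+X. point_count (X \<inter> A) \<partial>\<nu>)"
  proof (rule countably_additiveI)
    fix A :: "nat \<Rightarrow> 'a set"
    assume A: "range A \<subseteq> sets borel" "disjoint_family A"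
    have "point_count (X \<inter> (\<Union>i. A i)) = (\<Sum>i. point_count (X \<inter> A i))" for X
    proof -
      have "X \<inter> (\<Union>i. A i) = (\<Union>i. X \<inter> A i)" by blast
      moreover have "disjoint_family (\<lambda>i. X \<inter> A i)"
        using A(2) by (auto simp: disjoint_family_on_def)
      ultimately show ?thesis
        by (simp only: point_count_disjoint_UN)
    qed
    then show "(\<Sum>i. \<integral>\<^sup>+X. point_count (X \<inter> A i) \<partial>\<nu>) = (\<integral>\<^sup>+X. point_count (X \<inter> (\<Union>i. A i)) \<partial>\<nu>)"
      using A(1) point_count_measurable by (simp add: nn_integral_suminf image_subset_iff)
  qed
qed (rule assms)

lemma intensity_separated_le_1:
  assumes "A \<in> sets borel" "separated_by D A" shows "emeasure intensity A \<le> 1"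
proof -
  have "emeasure intensity A \<le> (\<integral>\<^sup>+X. 1 \<partial>\<nu>)"
    unfolding emeasure_intensity[OF assms(1)]
    by (intro nn_integral_mono point_count_le_1 assms(2))
  then show ?thesis by (simp add: emeasure_space_1)
qed

text \<open>Finitely many windows cover \<open>K\<close>, and each window has intensity at most
  1.\<close>

lemma intensity_compact: assumes "compact K" shows "emeasure intensity K < \<infinity>"
proof -
  obtain T where T: "finite T" "K \<subseteq> (\<Union>g\<in>T. g +o V)"
    using compact_cover[OF assms] .
  have V: "g +o V \<in> sets borel" for g
    using open_translate_V by simp
  have "emeasure intensity K \<le> emeasure intensity (\<Union>g\<in>T. g +o V)"
    using T(2) by (rule emeasure_mono)
      (unfold sets_intensity, intro borel_open open_UN ballI open_translate_V)
  also have "\<dots> \<le> (\<Sum>g\<in>T. emeasure intensity (g +o V))"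
    using T(1) V by (intro emeasure_subadditive_finite) (auto simp: sets_intensity)
  also have "\<dots> \<le> (\<Sum>g\<in>T. 1)"
    by (intro sum_mono intensity_separated_le_1 V separated_translate_V)
  also have "\<dots> < \<infinity>"
    by (simp add: of_nat_less_top)
  finally show ?thesis .
qed

lemma radon_intensity: "radon_measure intensity"
  using radon_measureI[OF lc sets_intensity intensity_compact] .

text \<open>Campbell's formula. Measurability of the inner integral belongs to the induction claim
  because additivity and monotone convergence for \<nu> require it.\<close>

lemma nn_integral_intensity:
  fixes f :: "'a \<Rightarrow> ennreal"
  assumes "f \<in> borel_measurable borel"
  shows "(\<lambda>X. \<integral>\<^sup>+x. f x \<partial>count_space X) \<in> borel_measurable \<nu> \<and>
    (\<integral>\<^sup>+x. f x \<partial>intensity) = (\<integral>\<^sup>+X. \<integral>\<^sup>+x. f x \<partial>count_space X \<partial>\<nu>)"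
  using assms
proof (induction rule: borel_measurable_induct)
  case (cong f g)
  then have "f = g" by auto
  then show ?case using cong by simp
next
  case (set A)
  then have "A \<in> sets intensity" by (simp add: sets_intensity)
  then show ?case
    using set point_count_measurable
    by (simp add: nn_integral_count_space_indicator_set emeasure_intensity)
next
  case (mult u c)
  have u: "u \<in> borel_measurable intensity"
    using mult(2) by (simp add: measurable_cong_sets[OF sets_intensity refl])
  show ?case
    using mult.IH u by (auto simp: nn_integral_cmult intro!: borel_measurable_times)
next
  case (add u v)
  have u: "u \<in> borel_measurable intensity" "v \<in> borel_measurable intensity"
    using add.hyps by (simp_all add: measurable_cong_sets[OF sets_intensity refl])
  show ?case
    using add.IH u by (auto simp: nn_integral_add intro!: borel_measurable_add)
next
  case (seq U)
  have u: "U i \<in> borel_measurable intensity" for i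
    using seq(1) by (simp add: measurable_cong_sets[OF sets_intensity refl])
  have eq: "(\<integral>\<^sup>+x. (SUP i. U i) x \<partial>count_space X) = (SUP i. \<integral>\<^sup>+x. U i x \<partial>count_space X)" for X
    using seq.hyps by (simp add: image_comp nn_integral_monotone_convergence_SUP)
  have inc: "incseq (\<lambda>i X. \<integral>\<^sup>+x. U i x \<partial>count_space X)"
    using seq.hyps by (auto simp: incseq_def le_fun_def intro!: nn_integral_mono)
  have "(\<integral>\<^sup>+x. (SUP i. U i) x \<partial>intensity) = (SUP i. \<integral>\<^sup>+x. U i x \<partial>intensity)"
    using seq.hyps u by (simp add: image_comp nn_integral_monotone_convergence_SUP)
  also have "\<dots> = (SUP i. \<integral>\<^sup>+X. \<integral>\<^sup>+x. U i x \<partial>count_space X \<partial>\<nu>)"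
    using seq.IH by simp
  also have "\<dots> = (\<integral>\<^sup>+X. (SUP i. \<integral>\<^sup>+x. U i x \<partial>count_space X) \<partial>\<nu>)"
    using seq.IH inc by (intro nn_integral_monotone_convergence_SUP[symmetric]) auto
  finally have "(\<integral>\<^sup>+x. (SUP i. U i) x \<partial>intensity) = (\<integral>\<^sup>+X. (SUP i. \<integral>\<^sup>+x. U i x \<partial>count_space X) \<partial>\<nu>)" .
  moreover have "(\<lambda>X. \<integral>\<^sup>+x. U i x \<partial>count_space X) \<in> borel_measurable \<nu>" for i
    using seq.IH by simp
  then have "(\<lambda>X. SUP i. \<integral>\<^sup>+x. U i x \<partial>count_space X) \<in> borel_measurable \<nu>"
    by (intro borel_measurable_SUP) auto
  ultimately show ?case
    unfolding eq by (intro conjI)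
qed

text \<open>Campbell's formula is applied to the positive and negative parts of \<open>f\<close>,
  whose integrals are finite, and the results are subtracted.\<close>

lemma integral_intensity:
  assumes f: "f \<in> Cc"
  shows "(\<integral>x. f x \<partial>intensity) = (\<integral>X. periodization \<Lambda> f X \<partial>\<nu>)"
proof -
  have fm: "f \<in> borel_measurable borel"
    using f by (rule Cc_borel_measurable)
  let ?p = "\<lambda>X. \<integral>\<^sup>+x. ennreal (f x) \<partial>count_space X"
  let ?n = "\<lambda>X. \<integral>\<^sup>+x. ennreal (- f x) \<partial>count_space X"
  have pm: "?p \<in> borel_measurable \<nu>" "(\<integral>\<^sup>+x. ennreal (f x) \<partial>intensity) = (\<integral>\<^sup>+X. ?p X \<partial>\<nu>)"
    using nn_integral_intensity[of "\<lambda>x. ennreal (f x)"] fm by auto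
  have nm: "?n \<in> borel_measurable \<nu>" "(\<integral>\<^sup>+x. ennreal (- f x) \<partial>intensity) = (\<integral>\<^sup>+X. ?n X \<partial>\<nu>)"
    using nn_integral_intensity[of "\<lambda>x. ennreal (- f x)"] fm by auto
  have int: "integrable intensity f"
    using sets_intensity intensity_compact f by (rule Cc_integrable)
  have abs: "Infinite_Set_Sum.abs_summable_on f X" if X: "X \<in> space \<nu>" for X
  proof -
    let ?K = "closure {x. f x \<noteq> 0}"
    have K: "compact ?K" using f by (simp add: Cc_def)
    have X': "uminus ` X + X \<subseteq> D"
      using X by (simp add: space_\<nu> hull_diff_set)
    have sub: "{x \<in> X. f x \<noteq> 0} \<subseteq> X \<inter> ?K"
      using closure_subset[of "{x. f x \<noteq> 0}"] by auto
    have fin: "finite (X \<inter> ?K)"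
      by (rule finite_Int_compact[OF X' K])
    have "Infinite_Set_Sum.abs_summable_on f (X \<inter> ?K)"
      using fin by (rule abs_summable_on_finite)
    then show ?thesis
      using sub by (subst Infinite_Set_Sum.abs_summable_on_cong_neutral[where B = "X \<inter> ?K" and g = f]) auto
  qed
  have fin: "?p X < \<infinity>" "?n X < \<infinity>" and per: "periodization \<Lambda> f X = enn2real (?p X) - enn2real (?n X)"
    if X: "X \<in> space \<nu>" for X
  proof -
    have i: "integrable (count_space X) f"
      using abs[OF X] by (simp add: Infinite_Set_Sum.abs_summable_on_def)
    then show "?p X < \<infinity>" "?n X < \<infinity>"
      by (auto simp: real_integrable_def less_top)
    \<comment> \<open>\<open>periodization\<close> is \<open>undefined\<close> outside the extended
      hull, so unfolding its value rests on the inclusion of the hull.\<close>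
    have "periodization \<Lambda> f X = infsum f X"
      using X invariant_hull_subset by (auto simp: periodization_def space_\<nu>)
    also have "\<dots> = (\<integral>x. f x \<partial>count_space X)"
      using infsetsum_infsum[OF abs[OF X]] by (simp add: infsetsum_def)
    also have "\<dots> = enn2real (?p X) - enn2real (?n X)"
      using i by (rule real_lebesgue_integral_def)
    finally show "periodization \<Lambda> f X = enn2real (?p X) - enn2real (?n X)" .
  qed
  have *: "integrable \<nu> (\<lambda>X. enn2real (h X)) \<and> (\<integral>X. enn2real (h X) \<partial>\<nu>) = enn2real (\<integral>\<^sup>+X. h X \<partial>\<nu>)"
    if h: "h \<in> borel_measurable \<nu>" "\<And>X. X \<in> space \<nu> \<Longrightarrow> h X < \<infinity>" "(\<integral>\<^sup>+X. h X \<partial>\<nu>) < \<infinity>" for h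
  proof -
    have eq: "(\<integral>\<^sup>+X. ennreal (enn2real (h X)) \<partial>\<nu>) = (\<integral>\<^sup>+X. h X \<partial>\<nu>)"
      using h(2) by (intro nn_integral_cong) simp
    then have "integrable \<nu> (\<lambda>X. enn2real (h X))"
      using h by (intro integrableI_nonneg) auto
    moreover have "(\<integral>X. enn2real (h X) \<partial>\<nu>) = enn2real (\<integral>\<^sup>+X. ennreal (enn2real (h X)) \<partial>\<nu>)"
      using h by (intro integral_eq_nn_integral) auto
    ultimately show ?thesis using eq by simp
  qed
  have lt: "(\<integral>\<^sup>+X. ?p X \<partial>\<nu>) < \<infinity>" "(\<integral>\<^sup>+X. ?n X \<partial>\<nu>) < \<infinity>"
    using int pm(2) nm(2) by (auto simp: real_integrable_def less_top)
  have "(\<integral>X. periodization \<Lambda> f X \<partial>\<nu>) = (\<integral>X. enn2real (?p X) - enn2real (?n X) \<partial>\<nu>)"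
    by (intro Bochner_Integration.integral_cong refl per)
  also have "\<dots> = enn2real (\<integral>\<^sup>+X. ?p X \<partial>\<nu>) - enn2real (\<integral>\<^sup>+X. ?n X \<partial>\<nu>)"
    using *[OF pm(1) fin(1) lt(1)] *[OF nm(1) fin(2) lt(2)] by simp
  also have "\<dots> = (\<integral>x. f x \<partial>intensity)"
    using int pm(2) nm(2) by (simp add: real_lebesgue_integral_def)
  finally show ?thesis by simp
qed

text \<open>
  Existence and uniqueness both matter here: on an unsatisfied description, \<open>THE\<close> would
  make \<open>periodization_dual\<close> an arbitrary measure.
\<close>

lemma periodization_dual_eq: "periodization_dual \<Lambda> \<nu> = intensity"
  unfolding periodization_dual_def
proof (rule the_equality)
  show "radon_measure intensity \<and> (\<forall>f\<in>Cc. (\<integral>x. f x \<partial>intensity) = (\<integral>X. periodization \<Lambda> f X \<partial>\<nu>))"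
    using radon_intensity integral_intensity by blast
  fix \<eta> assume \<eta>: "radon_measure \<eta> \<and> (\<forall>f\<in>Cc. (\<integral>x. f x \<partial>\<eta>) = (\<integral>X. periodization \<Lambda> f X \<partial>\<nu>))"
  show "\<eta> = intensity"
    by (rule radon_measure_unique[OF lc _ radon_intensity]) (use \<eta> integral_intensity in auto)
qed

end

subsection \<open>Orbit counting and mass transport\<close>

locale haar_approximate_subgroup = discrete_approximate_subgroup \<Lambda>
  for \<Lambda> :: "'a::{topological_group_add, t2_space, second_countable_topology} set" +
  fixes \<mu> :: "'a measure"
  assumes haar: "left_haar_measure \<mu>"
    and right_invariant: "\<And>A g. A \<in> sets borel \<Longrightarrow> emeasure \<mu> ((\<lambda>x. x + g) ` A) = emeasure \<mu> A"
begin

lemma sets_\<mu>: "sets \<mu> = sets borel"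
  using haar radon_measureD(1) by (auto simp: left_haar_measure_def)

definition orbit_count :: "'a set \<Rightarrow> 'a \<Rightarrow> ennreal" where
  "orbit_count A x = point_count ((x +o \<Lambda>) \<inter> A)"

lemma orbit_count_eq: "orbit_count A x = (\<integral>\<^sup>+l. indicator A (x + l) \<partial>count_space \<Lambda>)"
proof -
  have "bij_betw (\<lambda>l. x + l) \<Lambda> (x +o \<Lambda>)"
    by (auto simp: bij_betw_def inj_on_def elt_set_plus_def)
  from nn_integral_bij_count_space[OF this, of "indicator A"] show ?thesis
    by (simp add: orbit_count_def nn_integral_count_space_indicator_set)
qed

lemma indicator_translate_measurable:
  assumes "A \<in> sets borel" shows "(\<lambda>x. indicator A (x + g) :: ennreal) \<in> borel_measurable \<mu>"
proof -
  have "(\<lambda>x. x + g) \<in> borel \<rightarrow>\<^sub>M borel"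
    by (intro borel_measurable_continuous_onI continuous_intros)
  then have "(\<lambda>x. indicator A (x + g) :: ennreal) \<in> borel_measurable borel"
    using borel_measurable_indicator[OF assms] by (rule measurable_compose)
  then show ?thesis
    by (simp add: measurable_cong_sets[OF sets_\<mu> refl])
qed

text \<open>Right translation by \<open>g\<close> carries the points of \<open>A\<close> that land
  in \<open>B\<close> onto the points of \<open>B\<close> that come from \<open>A\<close>, and right
  invariance preserves their measure.\<close>

lemma nn_integral_translate_product:
  assumes "A \<in> sets borel" "B \<in> sets borel"
  shows "(\<integral>\<^sup>+x. indicator A x * indicator B (x + g) \<partial>\<mu>) = (\<integral>\<^sup>+x. indicator B x * indicator A (x + - g) \<partial>\<mu>)"
proof -
  have tr: "(\<lambda>x. x + h) ` C = {x. x + - h \<in> C}" for h :: 'a and C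
    by (auto simp: image_iff add.assoc intro!: bexI[of _ "_ + - h"])
  let ?S = "A \<inter> (\<lambda>x. x + - g) ` B"
  have S: "?S \<in> sets borel" and S': "B \<inter> (\<lambda>x. x + g) ` A \<in> sets borel"
    by (intro sets.Int assms right_translate_borel)+
  have "(\<integral>\<^sup>+x. indicator A x * indicator B (x + g) \<partial>\<mu>) = (\<integral>\<^sup>+x. indicator ?S x \<partial>\<mu>)"
    unfolding tr by (intro nn_integral_cong) (auto split: split_indicator)
  also have "\<dots> = emeasure \<mu> ?S"
    using S by (simp add: sets_\<mu>)
  also have "\<dots> = emeasure \<mu> ((\<lambda>x. x + g) ` ?S)"
    using right_invariant[OF S] by simp
  also have "(\<lambda>x. x + g) ` ?S = B \<inter> (\<lambda>x. x + g) ` A"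
    unfolding tr by (auto simp: add.assoc)
  also have "emeasure \<mu> (B \<inter> (\<lambda>x. x + g) ` A) = (\<integral>\<^sup>+x. indicator (B \<inter> (\<lambda>x. x + g) ` A) x \<partial>\<mu>)"
    using S' by (simp add: sets_\<mu>)
  also have "\<dots> = (\<integral>\<^sup>+x. indicator B x * indicator A (x + - g) \<partial>\<mu>)"
    by (intro nn_integral_cong) (auto simp: tr split: split_indicator)
  finally show ?thesis .
qed

text \<open>
  A mass transport principle: both sides count the pairs \<open>(x, l)\<close> with \<open>x \<in> A\<close>, \<open>l \<in> \<Lambda>\<close>,
  \<open>x + l \<in> B\<close>. Unimodularity enters the argument mainly here.
\<close>

lemma orbit_count_transport:
  assumes "A \<in> sets borel" "B \<in> sets borel"
  shows "(\<integral>\<^sup>+x. indicator A x * orbit_count B x \<partial>\<mu>) = (\<integral>\<^sup>+x. indicator B x * orbit_count A x \<partial>\<mu>)"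
proof -
  have expand: "(\<integral>\<^sup>+x. indicator A x * orbit_count B x \<partial>\<mu>) =
      (\<integral>\<^sup>+l. \<integral>\<^sup>+x. indicator A x * indicator B (x + l) \<partial>\<mu> \<partial>count_space \<Lambda>)"
    if "A \<in> sets borel" "B \<in> sets borel" for A B
  proof -
    have "(\<integral>\<^sup>+x. indicator A x * orbit_count B x \<partial>\<mu>) =
        (\<integral>\<^sup>+x. \<integral>\<^sup>+l. indicator A x * indicator B (x + l) \<partial>count_space \<Lambda> \<partial>\<mu>)"
      by (simp add: orbit_count_eq nn_integral_cmult)
    also have "\<dots> = (\<integral>\<^sup>+l. \<integral>\<^sup>+x. indicator A x * indicator B (x + l) \<partial>\<mu> \<partial>count_space \<Lambda>)"
      using that by (intro nn_integral_count_space_nn_integral countable_\<Lambda> borel_measurable_times_ennreal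
          indicator_translate_measurable borel_measurable_indicator) (auto simp: sets_\<mu>)
    finally show ?thesis .
  qed
  \<comment> \<open>Since \<Lambda> is symmetric, replacing \<open>l\<close> by \<open>- l\<close>
    only permutes the sum.\<close>
  have bij: "bij_betw uminus \<Lambda> \<Lambda>"
    by (simp add: bij_betw_def uminus_image)
  have "(\<integral>\<^sup>+x. indicator A x * orbit_count B x \<partial>\<mu>) =
      (\<integral>\<^sup>+l. \<integral>\<^sup>+x. indicator B x * indicator A (x + - l) \<partial>\<mu> \<partial>count_space \<Lambda>)"
    unfolding expand[OF assms] nn_integral_translate_product[OF assms] ..
  also have "\<dots> = (\<integral>\<^sup>+l. \<integral>\<^sup>+x. indicator B x * indicator A (x + l) \<partial>\<mu> \<partial>count_space \<Lambda>)"
    by (rule nn_integral_bij_count_space[OF bij])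
  also have "\<dots> = (\<integral>\<^sup>+x. indicator B x * orbit_count A x \<partial>\<mu>)"
    using expand[OF assms(2,1)] ..
  finally show ?thesis .
qed

lemma orbit_count_separated_le_1: "separated_by D A \<Longrightarrow> orbit_count A x \<le> 1"
  unfolding orbit_count_def
  by (rule emeasure_count_subsingleton_le)
    (rule subsingleton_Int_separated[of "x +o \<Lambda>" D A], simp_all add: diff_set_left_translate)

text \<open>If \<open>x = a + l\<close>, symmetry of \<Lambda> puts \<open>a = x + - l\<close> into
  \<open>x +o \<Lambda>\<close>.\<close>

lemma orbit_count_ge_1: assumes "A + \<Lambda> = UNIV" shows "1 \<le> orbit_count A x"
proof -
  have "x \<in> A + \<Lambda>" using assms by simp
  then obtain a l where al: "a \<in> A" "l \<in> \<Lambda>" "x = a + l"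
    by (auto elim: set_plus_elim)
  have "x + - l \<in> x +o \<Lambda>"
    using uminus_mem[OF al(2)] by (rule set_plus_intro2)
  then have "a \<in> x +o \<Lambda>"
    using al(3) by (simp add: add.assoc)
  then have "point_count {a} \<le> orbit_count A x"
    unfolding orbit_count_def using al(1) by (intro emeasure_mono) auto
  then show ?thesis by simp
qed

text \<open>Mass is sent from \<open>E\<close> to \<open>F\<close>: each point of \<open>E\<close>
  sends at least 1, and each point of \<open>F\<close> receives at most 1.\<close>

lemma packing_le_covering:
  assumes E: "E \<in> sets borel" "separated_by D E" and F: "F \<in> sets borel" "F + \<Lambda> = UNIV"
  shows "emeasure \<mu> E \<le> emeasure \<mu> F"
proof -
  have "emeasure \<mu> E = (\<integral>\<^sup>+x. indicator E x * 1 \<partial>\<mu>)"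
    using E(1) by (simp add: sets_\<mu>)
  also have "\<dots> \<le> (\<integral>\<^sup>+x. indicator E x * orbit_count F x \<partial>\<mu>)"
    by (intro nn_integral_mono mult_left_mono orbit_count_ge_1 F(2)) simp
  also have "\<dots> = (\<integral>\<^sup>+x. indicator F x * orbit_count E x \<partial>\<mu>)"
    using E(1) F(1) by (rule orbit_count_transport)
  also have "\<dots> \<le> (\<integral>\<^sup>+x. indicator F x * 1 \<partial>\<mu>)"
    by (intro nn_integral_mono mult_left_mono orbit_count_separated_le_1 E(2)) simp
  also have "\<dots> = emeasure \<mu> F"
    using F(1) by (simp add: sets_\<mu>)
  finally show ?thesis .
qed

lemma emeasure_set_plus_finite:
  assumes "E \<in> sets borel" "emeasure \<mu> E < \<infinity>" "finite T"
  shows "emeasure \<mu> (E + T) < \<infinity>"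
proof -
  have "E + T = (\<Union>t\<in>T. (\<lambda>x. x + t) ` E)"
    by (auto simp: set_plus_def)
  also have "emeasure \<mu> \<dots> \<le> (\<Sum>t\<in>T. emeasure \<mu> ((\<lambda>x. x + t) ` E))"
    using assms(1,3) by (intro emeasure_subadditive_finite) (auto simp: sets_\<mu> right_translate_borel)
  also have "\<dots> = (\<Sum>t\<in>T. emeasure \<mu> E)"
    by (simp add: right_invariant[OF assms(1)])
  also have "\<dots> < \<infinity>"
    using assms(2) by (simp add: ennreal_mult_less_top of_nat_less_top)
  finally show ?thesis .
qed

text \<open>
  For \<open>t \<in> T\<close> the set \<open>\<Lambda> - t\<close> lies in the fourth power of \<open>\<Lambda>\<close>, hence in finitely many
  translates of \<open>\<Lambda>\<close>, and each translate meets \<open>E\<close> at most once.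
\<close>

lemma orbit_count_set_plus_bounded:
  assumes E: "separated_by D E" and T: "finite T" "T \<subseteq> \<Lambda> + \<Lambda> + \<Lambda>" "\<Lambda> + \<Lambda> \<subseteq> T + \<Lambda>"
  shows "\<exists>M::nat. \<forall>x. orbit_count (E + T) x \<le> of_nat M"
proof -
  let ?S = "T + T + T"
  have S: "finite ?S" using T(1) by (intro finite_set_plus)
  \<comment> \<open>Each absorption of \<open>\<Lambda> + \<Lambda>\<close> into
    \<open>T + \<Lambda>\<close> removes one factor \<Lambda>, so four factors cost three copies of
    \<open>T\<close>.\<close>
  have cover4: "\<Lambda> + (\<Lambda> + \<Lambda> + \<Lambda>) \<subseteq> ?S + \<Lambda>"
  proof -
    have "\<Lambda> + (\<Lambda> + \<Lambda> + \<Lambda>) = (\<Lambda> + \<Lambda>) + (\<Lambda> + \<Lambda>)" by (simp add: add.assoc)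
    also have "\<dots> \<subseteq> (T + \<Lambda>) + (\<Lambda> + \<Lambda>)" by (intro set_plus_mono2 T(3) order_refl)
    also have "\<dots> = T + ((\<Lambda> + \<Lambda>) + \<Lambda>)" by (simp add: add.assoc)
    also have "\<dots> \<subseteq> T + ((T + \<Lambda>) + \<Lambda>)" by (intro set_plus_mono2 T(3) order_refl)
    also have "\<dots> = T + T + (\<Lambda> + \<Lambda>)" by (simp add: add.assoc)
    also have "\<dots> \<subseteq> T + T + (T + \<Lambda>)" by (intro set_plus_mono2 T(3) order_refl)
    finally show ?thesis by (simp add: add.assoc)
  qed
  have "orbit_count (E + T) x \<le> of_nat (card (T \<times> ?S))" for x
  proof -
    \<comment> \<open>Here \<open>t\<close> records which right translate of \<open>E\<close>
      contains \<open>y\<close>, and \<open>s\<close> which left translate of \<Lambda> contains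
      \<open>y + - t\<close>; each pair accounts for at most one \<open>y\<close>.\<close>
    let ?Y = "\<lambda>(t, s). {y. y + - t \<in> ((x + s) +o \<Lambda>) \<inter> E}"
    have sub: "(x +o \<Lambda>) \<inter> (E + T) \<subseteq> (\<Union>p\<in>T \<times> ?S. ?Y p)"
    proof
      fix y assume y: "y \<in> (x +o \<Lambda>) \<inter> (E + T)"
      then obtain e t where et: "e \<in> E" "t \<in> T" "y = e + t"
        by (auto elim: set_plus_elim)
      obtain l where l: "l \<in> \<Lambda>" "y = x + l"
        using y by (auto simp: elt_set_plus_def)
      have "t \<in> \<Lambda> + \<Lambda> + \<Lambda>"
        using et(2) T(2) by blast
      then obtain a b c where "a \<in> \<Lambda>" "b \<in> \<Lambda>" "c \<in> \<Lambda>" "t = a + b + c"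
        by (auto elim!: set_plus_elim)
      then have "- c + - b + - a \<in> \<Lambda> + \<Lambda> + \<Lambda>" "- t = - c + - b + - a"
        by (auto simp: minus_add add.assoc simp del: add_uminus_conv_diff intro!: set_plus_intro uminus_mem)
      then have "l + - t \<in> \<Lambda> + (\<Lambda> + \<Lambda> + \<Lambda>)"
        using l(1) by (intro set_plus_intro) auto
      then have "l + - t \<in> ?S + \<Lambda>" using cover4 by blast
      then obtain s k where sk: "s \<in> ?S" "k \<in> \<Lambda>" "l + - t = s + k"
        by (rule set_plus_elim)
      have eq: "y + - t = (x + s) + k"
        using l(2) sk(3) by (simp only: add.assoc)
      have "y + - t \<in> (x + s) +o \<Lambda>"
        unfolding eq using sk(2) by (rule set_plus_intro2)
      moreover have "y + - t \<in> E"
        using et(1,3) by (simp add: add.assoc)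
      ultimately have "y \<in> ?Y (t, s)"
        by simp
      then show "y \<in> (\<Union>p\<in>T \<times> ?S. ?Y p)"
        using et(2) sk(1) by blast
    qed
    have le1: "point_count (?Y p) \<le> 1" for p
    proof (rule emeasure_count_subsingleton_le)
      fix y z assume yz: "y \<in> ?Y p" "z \<in> ?Y p"
      obtain t s where p: "p = (t, s)" by (cases p)
      have "y + - t = z + - t"
        by (rule subsingleton_Int_separated[of "(x + s) +o \<Lambda>" D E])
          (use yz E in \<open>simp_all only: p prod.case mem_Collect_eq diff_set_left_translate order_refl\<close>)
      then show "y = z" by (rule add_right_imp_eq)
    qed
    have "orbit_count (E + T) x \<le> point_count (\<Union>p\<in>T \<times> ?S. ?Y p)"
      unfolding orbit_count_def using sub by (intro emeasure_mono) auto
    also have "\<dots> \<le> (\<Sum>p\<in>T \<times> ?S. point_count (?Y p))"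
      using T(1) S by (intro emeasure_subadditive_finite finite_cartesian_product) auto
    also have "\<dots> \<le> (\<Sum>p\<in>T \<times> ?S. 1)"
      by (intro sum_mono le1)
    finally show ?thesis by simp
  qed
  then show ?thesis by blast
qed

section \<open>Orbit measures and the two implications\<close>

lemma orbit_measurable:
  "(\<lambda>x. x +o \<Lambda>) \<in> borel \<rightarrow>\<^sub>M borel_of_topology (subtopology chabauty_fell (invariant_hull \<Lambda>))"
  unfolding borel_of_topology_def
proof (rule measurable_measure_of)
  let ?T = "subtopology chabauty_fell (invariant_hull \<Lambda>)"
  show "{U. openin ?T U} \<subseteq> Pow (topspace ?T)"
    using openin_subset by blast
  show "(\<lambda>x. x +o \<Lambda>) \<in> space borel \<rightarrow> topspace ?T"
    using orbit_mem_hull closure_of_subset_topspace[of chabauty_fell "range (\<lambda>g. g +o \<Lambda>)"]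
    by (auto simp: invariant_hull_def)
  fix U assume "U \<in> {U. openin ?T U}"
  then obtain W where W: "openin chabauty_fell W" "U = W \<inter> invariant_hull \<Lambda>"
    by (auto simp: openin_subtopology)
  have "(\<lambda>x. x +o \<Lambda>) -` U = {x \<in> topspace euclidean. x +o \<Lambda> \<in> W}"
    using W(2) orbit_mem_hull by auto
  moreover have "openin euclidean {x \<in> topspace euclidean. x +o \<Lambda> \<in> W}"
    using continuous_orbit W(1) by (rule openin_continuous_map_preimage)
  ultimately show "(\<lambda>x. x +o \<Lambda>) -` U \<inter> space borel \<in> sets borel"
    by simp
qed

lemma covering_imp_hull_measure:
  assumes F: "F \<in> sets borel" "emeasure \<mu> F < \<infinity>" "F + \<Lambda> = UNIV"
  shows "\<exists>\<nu> C. borel_prob_on_hull \<Lambda> \<nu> \<and> C \<ge> (1::real) \<and>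
      (\<forall>A\<in>sets borel.
        ennreal (1 / C) * emeasure \<mu> A \<le> emeasure (periodization_dual \<Lambda> \<nu>) A \<and>
        emeasure (periodization_dual \<Lambda> \<nu>) A \<le> ennreal C * emeasure \<mu> A)"
proof -
  obtain E where E: "E \<in> sets borel" "separated_by D E" "E + D = UNIV"
    using maximal_packing by blast
  obtain T where T: "finite T" "T \<subseteq> \<Lambda> + \<Lambda> + \<Lambda>" "\<Lambda> + \<Lambda> \<subseteq> T + \<Lambda>"
    using \<Lambda>_cover by blast
  let ?G = "E + T"
  have G: "?G \<in> sets borel"
    using E(1) countable_finite[OF T(1)] by (rule set_plus_borel)
  have "E + D \<subseteq> E + (T + \<Lambda>)"
    unfolding D_eq by (intro set_plus_mono2 T(3) order_refl)
  then have G_cover: "?G + \<Lambda> = UNIV"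
    using E(3) by (auto simp: add.assoc)
  have "emeasure \<mu> E < \<infinity>"
    using packing_le_covering[OF E(1,2) F(1,3)] F(2) by (rule le_less_trans)
  then have G_fin: "emeasure \<mu> ?G < \<infinity>"
    using emeasure_set_plus_finite[OF E(1) _ T(1)] by blast
  obtain M :: nat where M: "\<And>x. orbit_count ?G x \<le> of_nat M"
    using orbit_count_set_plus_bounded[OF E(2) T] by blast
  \<comment> \<open>Every point of the group sends mass at least 1 to \<open>?G\<close>; were
    \<open>?G\<close> null, transport would make the whole group null.\<close>
  have G_pos: "emeasure \<mu> ?G \<noteq> 0"
  proof
    assume 0: "emeasure \<mu> ?G = 0"
    have "emeasure \<mu> UNIV = (\<integral>\<^sup>+x. indicator UNIV x * 1 \<partial>\<mu>)"
      using sets_eq_imp_space_eq[OF sets_\<mu>] by simp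
    also have "\<dots> \<le> (\<integral>\<^sup>+x. indicator UNIV x * orbit_count ?G x \<partial>\<mu>)"
      by (intro nn_integral_mono mult_left_mono orbit_count_ge_1 G_cover) simp
    also have "\<dots> = (\<integral>\<^sup>+x. indicator ?G x * orbit_count UNIV x \<partial>\<mu>)"
      using G by (intro orbit_count_transport) auto
    also have "\<dots> = (\<integral>\<^sup>+x. 0 \<partial>\<mu>)"
    proof (rule nn_integral_cong_AE)
      have "AE x in \<mu>. x \<notin> ?G"
        using 0 G by (intro AE_not_in) (auto simp: null_sets_def sets_\<mu>)
      \<comment> \<open>\<open>orbit_count UNIV x\<close> is infinite for infinite \<Lambda>, so the
        product has to vanish through the indicator alone.\<close>
      then show "AE x in \<mu>. indicator ?G x * orbit_count UNIV x = 0"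
        by eventually_elim simp
    qed
    finally show False
      using haar by (simp add: left_haar_measure_def)
  qed
  let ?H = "borel_of_topology (subtopology chabauty_fell (invariant_hull \<Lambda>))"
  let ?U = "uniform_measure \<mu> ?G"
  define \<nu> where "\<nu> = distr ?U ?H (\<lambda>x. x +o \<Lambda>)"
  have sU: "sets ?U = sets borel"
    by (simp add: sets_\<mu>)
  have orb: "(\<lambda>x. x +o \<Lambda>) \<in> ?U \<rightarrow>\<^sub>M ?H"
    using orbit_measurable by (simp add: measurable_cong_sets[OF sU refl])
  have "prob_space ?U"
    using G_pos G_fin by (intro prob_space_uniform_measure) (auto simp: less_top)
  then have "prob_space \<nu>"
    unfolding \<nu>_def using orb by (rule prob_space.prob_space_distr)
  then have \<nu>: "borel_prob_on_hull \<Lambda> \<nu>"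
    by (simp add: borel_prob_on_hull_def \<nu>_def)
  interpret hull_measure \<Lambda> \<nu>
    by unfold_locales (rule \<nu>)
  obtain m where m: "emeasure \<mu> ?G = ennreal m" "0 < m"
    using G_pos G_fin by (cases "emeasure \<mu> ?G") (auto simp: less_le)
  have val: "emeasure (periodization_dual \<Lambda> \<nu>) A = ennreal (1 / m) * (\<integral>\<^sup>+x. indicator A x * orbit_count ?G x \<partial>\<mu>)"
    if A: "A \<in> sets borel" for A
  proof -
    \<comment> \<open>As a distribution on \<open>?H\<close>, \<nu> has the same measurable sets, so
      measurability of counts transfers to \<open>?H\<close>.\<close>
    have point_count_H: "(\<lambda>X. point_count (X \<inter> A)) \<in> borel_measurable ?H"
      using point_count_measurable[OF A] by (simp add: \<nu>_def)
    have oc: "orbit_count A \<in> borel_measurable \<mu>"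
      using measurable_compose[OF orbit_measurable point_count_H]
      by (simp add: orbit_count_def[abs_def] measurable_cong_sets[OF sets_\<mu> refl])
    have "emeasure (periodization_dual \<Lambda> \<nu>) A = (\<integral>\<^sup>+X. point_count (X \<inter> A) \<partial>\<nu>)"
      by (simp add: periodization_dual_eq emeasure_intensity[OF A])
    also have "\<dots> = (\<integral>\<^sup>+x. orbit_count A x \<partial>?U)"
      unfolding \<nu>_def orbit_count_def by (rule nn_integral_distr[OF orb]) (simp add: point_count_H)
    also have "\<dots> = (\<integral>\<^sup>+x. orbit_count A x * indicator ?G x \<partial>\<mu>) / emeasure \<mu> ?G"
      using oc G by (intro nn_integral_uniform_measure) (auto simp: sets_\<mu>)
    \<comment> \<open>Transport exchanges \<open>A\<close> and \<open>?G\<close>, which exhibits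
      \<open>orbit_count ?G\<close> divided by \<open>m\<close> as the density of the dual.\<close>
    also have "(\<integral>\<^sup>+x. orbit_count A x * indicator ?G x \<partial>\<mu>) = (\<integral>\<^sup>+x. indicator A x * orbit_count ?G x \<partial>\<mu>)"
      using orbit_count_transport[OF G A] by (simp add: mult.commute)
    finally show ?thesis
      using m by (simp add: divide_ennreal_def inverse_ennreal inverse_eq_divide mult.commute)
  qed
  \<comment> \<open>The density lies between \<open>1 / m\<close> and \<open>M / m\<close>; the
    entry 1 secures \<open>1 \<le> C\<close>.\<close>
  define C where "C = max 1 (max m (real M / m))"
  have C: "1 \<le> C" "1 / C \<le> 1 / m" "real M / m \<le> C"
    using m(2) by (auto simp: C_def intro!: divide_left_mono mult_pos_pos)
  have lower: "ennreal (1 / C) * emeasure \<mu> A \<le> emeasure (periodization_dual \<Lambda> \<nu>) A"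
    if A: "A \<in> sets borel" for A
  proof -
    have "emeasure \<mu> A = (\<integral>\<^sup>+x. indicator A x * 1 \<partial>\<mu>)"
      using A by (simp add: sets_\<mu>)
    also have "\<dots> \<le> (\<integral>\<^sup>+x. indicator A x * orbit_count ?G x \<partial>\<mu>)"
      by (intro nn_integral_mono mult_left_mono orbit_count_ge_1 G_cover) simp
    finally show ?thesis
      unfolding val[OF A] using C(2) by (intro mult_mono ennreal_leI) auto
  qed
  have upper: "emeasure (periodization_dual \<Lambda> \<nu>) A \<le> ennreal C * emeasure \<mu> A"
    if A: "A \<in> sets borel" for A
  proof -
    have "(\<integral>\<^sup>+x. indicator A x * orbit_count ?G x \<partial>\<mu>) \<le> (\<integral>\<^sup>+x. of_nat M * indicator A x \<partial>\<mu>)"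
      using M by (intro nn_integral_mono) (auto split: split_indicator)
    also have "\<dots> = ennreal (real M) * emeasure \<mu> A"
      using A by (simp add: nn_integral_cmult_indicator sets_\<mu> ennreal_of_nat_eq_real_of_nat)
    finally have "emeasure (periodization_dual \<Lambda> \<nu>) A \<le> ennreal (1 / m) * (ennreal (real M) * emeasure \<mu> A)"
      unfolding val[OF A] by (intro mult_left_mono) auto
    also have "\<dots> = ennreal (real M / m) * emeasure \<mu> A"
      using m(2) by (simp add: ennreal_mult'[symmetric] mult.assoc[symmetric])
    also have "\<dots> \<le> ennreal C * emeasure \<mu> A"
      using C(3) by (intro mult_right_mono ennreal_leI) auto
    finally show ?thesis .
  qed
  show ?thesis
    using \<nu> C(1) lower upper by blast
qed

text \<open>Testing the lower bound on a maximal packing \<open>E\<close>, whose intensity is at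
  most 1, makes \<open>\<mu> E\<close> finite; right invariance keeps \<open>E + T\<close> of finite
  measure.\<close>

lemma hull_measure_imp_covering:
  assumes \<nu>: "borel_prob_on_hull \<Lambda> \<nu>" and C: "C \<ge> (1::real)"
    and le: "\<And>A. A \<in> sets borel \<Longrightarrow> ennreal (1 / C) * emeasure \<mu> A \<le> emeasure (periodization_dual \<Lambda> \<nu>) A"
  shows "\<exists>F. F \<in> sets borel \<and> emeasure \<mu> F < \<infinity> \<and> F + \<Lambda> = UNIV"
proof -
  interpret hull_measure \<Lambda> \<nu>
    by unfold_locales (rule \<nu>)
  obtain E where E: "E \<in> sets borel" "separated_by D E" "E + D = UNIV"
    using maximal_packing by blast
  obtain T where T: "finite T" "\<Lambda> + \<Lambda> \<subseteq> T + \<Lambda>"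
    using \<Lambda>_cover by blast
  have "ennreal (1 / C) * emeasure \<mu> E \<le> 1"
    using le[OF E(1)] intensity_separated_le_1[OF E(1,2)] by (simp add: periodization_dual_eq)
  moreover have "ennreal (1 / C) \<noteq> 0"
    using C by simp
  ultimately have "emeasure \<mu> E < \<infinity>"
    by (auto simp: less_top[symmetric] ennreal_mult_top top_unique)
  then have "emeasure \<mu> (E + T) < \<infinity>"
    using E(1) T(1) by (intro emeasure_set_plus_finite)
  moreover have "E + T \<in> sets borel"
    using E(1) countable_finite[OF T(1)] by (rule set_plus_borel)
  moreover have "E + D \<subseteq> E + (T + \<Lambda>)"
    unfolding D_eq by (intro set_plus_mono2 T(2) order_refl)
  then have "E + T + \<Lambda> = UNIV"
    using E(3) by (auto simp: add.assoc)
  ultimately show ?thesis by blast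
qed

end

theorem proposition5p4:
  fixes \<Lambda> :: "'a::{topological_group_add, t2_space, second_countable_topology} set"
    and \<mu> :: "'a measure"
  assumes "locally_compact_space (euclidean :: 'a topology)"
    and "unimodular TYPE('a)"
    and "approximate_subgroup \<Lambda>"
    and "uniformly_discrete \<Lambda>"
    and "left_haar_measure \<mu>"
  shows "(\<exists>\<F>. \<F> \<in> sets borel \<and> emeasure \<mu> \<F> < \<infinity> \<and> \<F> + \<Lambda> = UNIV) \<longleftrightarrow>
    (\<exists>\<nu> C. borel_prob_on_hull \<Lambda> \<nu> \<and> C \<ge> (1::real) \<and>
      (\<forall>A\<in>sets borel.
        ennreal (1 / C) * emeasure \<mu> A \<le> emeasure (periodization_dual \<Lambda> \<nu>) A \<and>
        emeasure (periodization_dual \<Lambda> \<nu>) A \<le> ennreal C * emeasure \<mu> A))"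
proof -
  interpret haar_approximate_subgroup \<Lambda> \<mu>
    using assms by unfold_locales (auto simp: unimodular_def)
  show ?thesis
    using covering_imp_hull_measure hull_measure_imp_covering by blast
qed

end
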